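(* Let $\mathfrak g$ be a graded Lie algebra as in the context, and let $U^\circ_+(\mathfrak g)=\{z\in U^\circ(\mathfrak g):z^{[0]}=0\}$. Then: (a) If $z,u\in U^\circ(\mathfrak g)$, then $zu\in U^\circ(\mathfrak g)$. (b) The algebra $U^\circ(\mathfrak g)$ does not depend on the choice of the basis $\omega_j$ of $\mathfrak g^{[1]}$. (c) If $z\in U^\circ_+(\mathfrak g)$ and $f(\xi)$ is an entire function, then $f(z)\in U^\circ(\mathfrak g)$. (d) If $z\in U^\circ_+(\mathfrak g)$, then $\exp(z)\in U^\circ(\mathfrak g)$.
   Context: $\mathfrak g=\bigoplus_{k>0}\mathfrak g^{[k]}$ is a graded real Lie algebra ($[\mathfrak g^{[k]},\mathfrak g^{[m]}]\subset\mathfrak g^{[k+m]}$), with $\dim\mathfrak g^{[k]}<\infty$, generated by $\mathfrak g^{[1]}$; the same constructions are applied to its complexification. $\omega_1,\dots,\omega_n$ is a basis of $\mathfrak g^{[1]}$. The universal enveloping algebra $U(\mathfrak g)=\bigoplus_{p\ge0}U(\mathfrak g)^{[p]}$ has the induced grading; $\overline U(\mathfrak g)=\prod_{p\ge 0}U(\mathfrak g)^{[p]}$ is the algebra of formal series $z=\sum_p z^{[p]}$. If $z\in\overline U(\mathfrak g)$ and $z^{[0]}=0$, then for any formal series $f(\xi)=\sum_{m\ge0}a_m\xi^m$ with $a_m\in\mathbb C$ the formal series $f(z)=\sum_m a_mz^m$ is well defined (if $\mathfrak g$ is real and some $a_m$ are not real, scalars are extended to $\mathbb C$, i.e. $f(z)$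 is regarded as a series with complex coefficients). For $z\in U(\mathfrak g)^{[p]}$ the norm is $\|z\|=\inf\sum_w|c_w|$, the infimum over all representations $z=\sum_w c_w w$ with scalar coefficients $c_w$ as a finite linear combination of words $w=\omega_{j_1}\cdots\omega_{j_p}$. $U^\circ(\mathfrak g)$ is the set of $z\in\overline U(\mathfrak g)$ such that $\sup_p\|z^{[p]}\|e^{Cp}<\infty$ for every real $C$. *)

theory Defs
  imports "HOL-Analysis.Analysis" "HOL-Library.Poly_Mapping" "HOL-Algebra.QuotRing"
begin

section \<open>Graded Lie algebras\<close>

record ('k, 'a) graded_lie =
  scl :: "'k \<Rightarrow> 'a \<Rightarrow> 'a"
  brk :: "'a \<Rightarrow> 'a \<Rightarrow> 'a"
  gr :: "nat \<Rightarrow> 'a set"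

text \<open>
  The Lie algebra is the whole type \<open>'a\<close>.  The grading is indexed by positive integers;
  as a convention the component of index \<open>0\<close> is the zero space.
\<close>

locale graded_lie_algebra = vector_space "scl L"
  for L :: "('k::field, 'a::ab_group_add) graded_lie" +
  assumes bracket_linear_left: "Vector_Spaces.linear (scl L) (scl L) (\<lambda>x. brk L x y)"
    and bracket_linear_right: "Vector_Spaces.linear (scl L) (scl L) (brk L x)"
    and bracket_self: "brk L x x = 0"
    and jacobi: "brk L x (brk L y z) + brk L y (brk L z x) + brk L z (brk L x y) = 0"
    and gr_0: "gr L 0 = {0}"
    and gr_subspace: "subspace (gr L k)"
    and gr_finite_dim: "\<exists>S. finite S \<and> span S = gr L k"
    and gr_direct_sum:
      "\<exists>!c. (\<forall>k. c k \<in> gr L k) \<and> finite {k. c k \<noteq> 0} \<and> x = (\<Sum>k | c k \<noteq> 0. c k)"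
    and gr_bracket: "x \<in> gr L k \<Longrightarrow> y \<in> gr L m \<Longrightarrow> brk L x y \<in> gr L (k + m)"
    and gr_generated:
      "subspace S \<Longrightarrow> (\<And>x y. x \<in> S \<Longrightarrow> y \<in> S \<Longrightarrow> brk L x y \<in> S) \<Longrightarrow> gr L 1 \<subseteq> S \<Longrightarrow> S = UNIV"

definition degree_one_basis :: "('k::field, 'a::ab_group_add) graded_lie \<Rightarrow> 'a set \<Rightarrow> bool" where
  "degree_one_basis L B \<longleftrightarrow>
     finite B \<and> \<not> Modules.module.dependent (scl L) B \<and> Modules.module.span (scl L) B = gr L 1"

text \<open>The pair \<open>(x, y)\<close> stands for \<open>x + i y\<close>.\<close>

definition complexification ::
    "(real, 'a::ab_group_add) graded_lie \<Rightarrow> (complex, 'a \<times> 'a) graded_lie" where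
  "complexification L = \<lparr>
     scl = (\<lambda>c (x, y). (scl L (Re c) x - scl L (Im c) y, scl L (Re c) y + scl L (Im c) x)),
     brk = (\<lambda>(x, y) (x', y'). (brk L x x' - brk L y y', brk L x y' + brk L y x')),
     gr = (\<lambda>k. gr L k \<times> gr L k)\<rparr>"

definition to_complex :: "'a::zero \<Rightarrow> 'a \<times> 'a" where
  "to_complex x = (x, 0)"


section \<open>The universal enveloping algebra\<close>

text \<open>
  Words over \<open>'a\<close> form the free monoid, written additively, so that the convolution product
  of \<^theory>\<open>HOL-Library.Poly_Mapping\<close> makes \<open>'a fword \<Rightarrow>\<^sub>0 'k\<close> the free associative unital
  \<open>'k\<close>-algebra on the set \<open>'a\<close>.
\<close>

datatype 'a fword = FWord (letters: "'a list")

instantiation fword :: (type) monoid_add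
begin

definition zero_fword :: "'a fword" where
  "zero_fword = FWord []"

definition plus_fword :: "'a fword \<Rightarrow> 'a fword \<Rightarrow> 'a fword" where
  "plus_fword v w = FWord (letters v @ letters w)"

instance
  by standard (simp_all add: zero_fword_def plus_fword_def)

end

definition free_alg :: "('a fword \<Rightarrow>\<^sub>0 'k::field) ring" where
  "free_alg = \<lparr>carrier = UNIV, monoid.mult = (*), one = 1, zero = 0, add = (+)\<rparr>"

definition word :: "'a list \<Rightarrow> 'a fword \<Rightarrow>\<^sub>0 'k::field" where
  "word xs = Poly_Mapping.single (FWord xs) 1"

definition const :: "'k \<Rightarrow> 'a fword \<Rightarrow>\<^sub>0 'k::field" where
  "const c = Poly_Mapping.single 0 c"

text \<open>
  The first two families of relations turn the free algebra on the underlying set of the Lie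
  algebra into its tensor algebra.
\<close>

definition env_relations :: "('k::field, 'a::ab_group_add) graded_lie \<Rightarrow> ('a fword \<Rightarrow>\<^sub>0 'k) set" where
  "env_relations L =
     {word [x + y] - word [x] - word [y] | x y. True} \<union>
     {word [scl L c x] - const c * word [x] | c x. True} \<union>
     {word [x] * word [y] - word [y] * word [x] - word [brk L x y] | x y. True}"

definition env_ideal :: "('k::field, 'a::ab_group_add) graded_lie \<Rightarrow> ('a fword \<Rightarrow>\<^sub>0 'k) set" where
  "env_ideal L = Idl\<^bsub>free_alg\<^esub> (env_relations L)"

definition env :: "('k::field, 'a::ab_group_add) graded_lie \<Rightarrow> ('a fword \<Rightarrow>\<^sub>0 'k) set ring" where
  "env L = free_alg Quot env_ideal L"

definition env_class ::
    "('k::field, 'a::ab_group_add) graded_lie \<Rightarrow> ('a fword \<Rightarrow>\<^sub>0 'k) \<Rightarrow> ('a fword \<Rightarrow>\<^sub>0 'k) set" where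
  "env_class L f = env_ideal L +>\<^bsub>free_alg\<^esub> f"

definition env_scale ::
    "('k::field, 'a::ab_group_add) graded_lie \<Rightarrow> 'k \<Rightarrow> ('a fword \<Rightarrow>\<^sub>0 'k) set \<Rightarrow> ('a fword \<Rightarrow>\<^sub>0 'k) set" where
  "env_scale L c u = env_class L (const c) \<otimes>\<^bsub>env L\<^esub> u"

text \<open>
  The component of degree \<open>p\<close> is spanned by the products \<open>x\<^sub>1 \<cdots> x\<^sub>m\<close> of
  homogeneous elements whose degrees add up to \<open>p\<close>.
\<close>

definition env_gr ::
    "('k::field, 'a::ab_group_add) graded_lie \<Rightarrow> nat \<Rightarrow> ('a fword \<Rightarrow>\<^sub>0 'k) set set" where
  "env_gr L p = env_class L `
     {f. \<forall>w \<in> Poly_Mapping.keys f.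
           \<exists>ks. list_all2 (\<lambda>x k. x \<in> gr L k) (letters w) ks \<and> sum_list ks = p}"


section \<open>Formal series\<close>

type_synonym ('k, 'a) env_series = "nat \<Rightarrow> ('a fword \<Rightarrow>\<^sub>0 'k) set"

definition env_bar :: "('k::field, 'a::ab_group_add) graded_lie \<Rightarrow> ('k, 'a) env_series ring" where
  "env_bar L = \<lparr>
     carrier = {z. \<forall>p. z p \<in> env_gr L p},
     monoid.mult = (\<lambda>z u p. \<Oplus>\<^bsub>env L\<^esub>k\<in>{..p}. z k \<otimes>\<^bsub>env L\<^esub> u (p - k)),
     one = (\<lambda>p. if p = 0 then \<one>\<^bsub>env L\<^esub> else \<zero>\<^bsub>env L\<^esub>),
     zero = (\<lambda>p. \<zero>\<^bsub>env L\<^esub>),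
     add = (\<lambda>z u p. z p \<oplus>\<^bsub>env L\<^esub> u p)\<rparr>"

text \<open>
  \<open>\<Sum>m. a\<^sub>m z\<^sup>m\<close>, meaningful when \<open>z 0\<close> is zero: then \<open>z\<^sup>m\<close> has no component of
  degree \<open>p < m\<close>, so that only the terms with \<open>m \<le> p\<close> contribute in degree \<open>p\<close>
  (see \<open>env_bar_pow_vanishes\<close> below).
\<close>

definition env_apply ::
    "('k::field, 'a::ab_group_add) graded_lie \<Rightarrow> (nat \<Rightarrow> 'k) \<Rightarrow> ('k, 'a) env_series \<Rightarrow> ('k, 'a) env_series" where
  "env_apply L a z = (\<lambda>p. \<Oplus>\<^bsub>env L\<^esub>m\<in>{..p}. env_scale L (a m) ((z [^]\<^bsub>env_bar L\<^esub> m) p))"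

definition env_exp ::
    "('k::field_char_0, 'a::ab_group_add) graded_lie \<Rightarrow> ('k, 'a) env_series \<Rightarrow> ('k, 'a) env_series" where
  "env_exp L = env_apply L (\<lambda>m. 1 / fact m)"

text \<open>
  The canonical map from the enveloping algebra to that of the complexification: on
  representatives, \<open>\<Sum> c\<^sub>w w\<close> goes to the same combination of the same words, with the
  letters and the coefficients regarded as complex ones.
\<close>

definition free_to_complex :: "('a::zero fword \<Rightarrow>\<^sub>0 real) \<Rightarrow> (('a \<times> 'a) fword \<Rightarrow>\<^sub>0 complex)" where
  "free_to_complex f =
     (\<Sum>w \<in> Poly_Mapping.keys f. const (of_real (Poly_Mapping.lookup f w)) * word (map to_complex (letters w)))"

definition env_to_complex ::
    "(real, 'a::ab_group_add) graded_lie \<Rightarrow> ('a fword \<Rightarrow>\<^sub>0 real) set \<Rightarrow> (('a \<times> 'a) fword \<Rightarrow>\<^sub>0 complex) set" where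
  "env_to_complex L u = (\<Union>f\<in>u. env_class (complexification L) (free_to_complex f))"


section \<open>Norms and the algebra of rapidly decreasing series\<close>

definition basis_words :: "'a set \<Rightarrow> nat \<Rightarrow> 'a list set" where
  "basis_words B p = {w. length w = p \<and> set w \<subseteq> B}"

text \<open>
  For \<open>u\<close> of degree \<open>p\<close> the set of representations is nonempty because the Lie algebra is
  generated by its component of degree \<open>1\<close>.
\<close>

definition env_norm ::
    "('k::real_normed_field, 'a::ab_group_add) graded_lie \<Rightarrow> 'a set \<Rightarrow> nat \<Rightarrow> ('a fword \<Rightarrow>\<^sub>0 'k) set \<Rightarrow> real" where
  "env_norm L B p u = Inf {\<Sum>w\<in>basis_words B p. norm (c w) | c.
     u = (\<Oplus>\<^bsub>env L\<^esub>w\<in>basis_words B p. env_scale L (c w) (env_class L (word w)))}"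

definition env_circ ::
    "('k::real_normed_field, 'a::ab_group_add) graded_lie \<Rightarrow> 'a set \<Rightarrow> ('k, 'a) env_series set" where
  "env_circ L B = {z \<in> carrier (env_bar L).
     \<forall>C::real. bdd_above (range (\<lambda>p. env_norm L B p (z p) * exp (C * real p)))}"

definition env_circ_plus ::
    "('k::real_normed_field, 'a::ab_group_add) graded_lie \<Rightarrow> 'a set \<Rightarrow> ('k, 'a) env_series set" where
  "env_circ_plus L B = {z \<in> env_circ L B. z 0 = \<zero>\<^bsub>env L\<^esub>}"


section \<open>Well-definedness\<close>

lemma ring_free_alg: "ring (free_alg :: ('a fword \<Rightarrow>\<^sub>0 'k::field) ring)"
proof (rule ringI)
  show "abelian_group (free_alg :: ('a fword \<Rightarrow>\<^sub>0 'k::field) ring)"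
    by (rule abelian_groupI) (auto simp: free_alg_def add_ac intro: exI[of _ "- x" for x])
  show "Group.monoid (free_alg :: ('a fword \<Rightarrow>\<^sub>0 'k::field) ring)"
    by (rule monoidI) (auto simp: free_alg_def mult.assoc)
qed (auto simp: free_alg_def algebra_simps)

lemma ideal_env_ideal: "ideal (env_ideal L) free_alg"
  unfolding env_ideal_def
  by (rule ring.genideal_ideal[OF ring_free_alg]) (simp add: free_alg_def)

lemma ring_env: "ring (env L)"
  unfolding env_def by (rule ideal.quotient_is_ring[OF ideal_env_ideal])

lemma env_gr_carrier: "env_gr L p \<subseteq> carrier (env L)"
  by (auto simp: env_gr_def env_def FactRing_def A_RCOSETS_def' env_class_def free_alg_def a_r_coset_def')

lemma env_bar_pow_carrier:
  assumes "\<And>p. z p \<in> carrier (env L)"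
  shows "(z [^]\<^bsub>env_bar L\<^esub> (m::nat)) p \<in> carrier (env L)"
proof -
  interpret U: ring "env L" by (rule ring_env)
  show ?thesis
  proof (induction m arbitrary: p)
    case 0
    then show ?case by (simp add: nat_pow_def env_bar_def)
  next
    case (Suc m)
    then show ?case
      using assms by (auto simp: nat_pow_def env_bar_def intro!: U.finsum_closed)
  qed
qed

lemma env_bar_pow_vanishes:
  assumes "z \<in> carrier (env_bar L)" "z 0 = \<zero>\<^bsub>env L\<^esub>" "p < m"
  shows "(z [^]\<^bsub>env_bar L\<^esub> (m::nat)) p = \<zero>\<^bsub>env L\<^esub>"
proof -
  interpret U: ring "env L" by (rule ring_env)
  have z: "z q \<in> carrier (env L)" for q
    using assms(1) env_gr_carrier by (fastforce simp: env_bar_def)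
  show ?thesis
    using assms(3)
  proof (induction m arbitrary: p)
    case 0
    then show ?case by simp
  next
    case (Suc m)
    have "(z [^]\<^bsub>env_bar L\<^esub> m) k \<otimes>\<^bsub>env L\<^esub> z (p - k) = \<zero>\<^bsub>env L\<^esub>" if "k \<le> p" for k
    proof (cases "k < m")
      case True
      then show ?thesis using Suc.IH z by simp
    next
      case False
      then have "p - k = 0" using that Suc.prems by simp
      then show ?thesis using assms(2) env_bar_pow_carrier[OF z] by simp
    qed
    then have "(\<Oplus>\<^bsub>env L\<^esub>k\<in>{..p}. (z [^]\<^bsub>env_bar L\<^esub> m) k \<otimes>\<^bsub>env L\<^esub> z (p - k)) = \<zero>\<^bsub>env L\<^esub>"
      by (intro U.add.finprod_one_eqI) auto
    then show ?case
      by (simp add: nat_pow_def env_bar_def)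
  qed
qed

lemma graded_lie_algebra_complexification:
  assumes "graded_lie_algebra L"
  shows "graded_lie_algebra (complexification L)"
proof -
  interpret graded_lie_algebra L by fact
  let ?C = "complexification L"
  note c_simps = complexification_def algebra_simps
  have vs: "vector_space (scl ?C)"
    by unfold_locales (auto simp: c_simps)
  interpret C: vector_space "scl ?C" by (rule vs)
  have bl_add: "brk L (x + x') y = brk L x y + brk L x' y" for x x' y
    using bracket_linear_left[of y] by (simp add: Vector_Spaces.linear_iff)
  have bl_scale: "brk L (scl L r x) y = scl L r (brk L x y)" for r x y
    using bracket_linear_left[of y] by (simp add: Vector_Spaces.linear_iff)
  have br_add: "brk L x (y + y') = brk L x y + brk L x y'" for x y y'
    using bracket_linear_right[of x] by (simp add: Vector_Spaces.linear_iff)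
  have br_scale: "brk L x (scl L r y) = scl L r (brk L x y)" for r x y
    using bracket_linear_right[of x] by (simp add: Vector_Spaces.linear_iff)
  have bl_diff: "brk L (x - x') y = brk L x y - brk L x' y" for x x' y
    using bl_add[of "x - x'" x' y] by (simp add: algebra_simps)
  have br_diff: "brk L x (y - y') = brk L x y - brk L x y'" for x y y'
    using br_add[of x "y - y'" y'] by (simp add: algebra_simps)
  have anti: "brk L x y = - brk L y x" for x y
  proof -
    have "brk L (x + y) (x + y) = brk L x y + brk L y x"
      unfolding bl_add br_add by (simp add: bracket_self)
    then show ?thesis using bracket_self by (simp add: eq_neg_iff_add_eq_0)
  qed
  note b_simps = bl_add bl_scale br_add br_scale bl_diff br_diff
  show ?thesis
  proof (rule graded_lie_algebra.intro[OF vs], rule graded_lie_algebra_axioms.intro)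
    fix x y z :: "'a \<times> 'a" and c d :: complex
    show "Vector_Spaces.linear (scl ?C) (scl ?C) (\<lambda>x. brk ?C x y)"
      unfolding Vector_Spaces.linear_iff using vs
      by (auto simp: c_simps b_simps split: prod.splits)
    show "Vector_Spaces.linear (scl ?C) (scl ?C) (brk ?C x)"
      unfolding Vector_Spaces.linear_iff using vs
      by (auto simp: c_simps b_simps split: prod.splits)
    show "brk ?C x x = 0"
      using anti[of "fst x" "snd x"] by (cases x) (auto simp: complexification_def bracket_self zero_prod_def)
    obtain x1 x2 y1 y2 z1 z2 where [simp]: "x = (x1, x2)" "y = (y1, y2)" "z = (z1, z2)"
      by (metis surj_pair)
    have J: "brk L a (brk L b c) = - brk L b (brk L c a) - brk L c (brk L a b)" for a b c
      using jacobi[of a b c] by (simp add: algebra_simps eq_neg_iff_add_eq_0)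
    show "brk ?C x (brk ?C y z) + brk ?C y (brk ?C z x) + brk ?C z (brk ?C x y) = 0"
      by (auto simp: complexification_def b_simps zero_prod_def J[of x1] J[of x2])
  next
    show "gr ?C 0 = {0}"
      by (auto simp: complexification_def gr_0 zero_prod_def)
  next
    fix k
    have s: "x + y \<in> gr L k" "scl L r x \<in> gr L k" "0 \<in> gr L k" "x - y \<in> gr L k"
      if "x \<in> gr L k" "y \<in> gr L k" for x y r
      using that gr_subspace[of k] by (auto intro: subspace_add subspace_scale subspace_0 subspace_diff)
    have 0: "0 \<in> gr L k" using gr_subspace by (rule subspace_0)
    show sub: "C.subspace (gr ?C k)"
      by (rule C.subspaceI) (auto simp: complexification_def s 0 zero_prod_def)
    obtain S where S: "finite S" "span S = gr L k" using gr_finite_dim by blast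
    have em: "to_complex x \<in> C.span (to_complex ` S)" if "x \<in> span S" for x
      using that
    proof (induction rule: span_induct_alt)
      case base
      show ?case using C.span_zero by (simp add: to_complex_def zero_prod_def)
    next
      case (step c x y)
      have "to_complex (scl L c x + y) = scl ?C (of_real c) (to_complex x) + to_complex y"
        by (simp add: to_complex_def complexification_def)
      then show ?case
        using step by (simp add: C.span_add C.span_base C.span_scale)
    qed
    have "C.span (to_complex ` S) = gr ?C k"
    proof
      show "C.span (to_complex ` S) \<subseteq> gr ?C k"
        using S(2) span_base[of _ S] 0
        by (intro C.span_minimal sub) (auto simp: complexification_def to_complex_def)
      show "gr ?C k \<subseteq> C.span (to_complex ` S)"
      proof
        fix v assume "v \<in> gr ?C k"
        then obtain x y where v: "v = (x, y)" "x \<in> span S" "y \<in> span S"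
          by (auto simp: complexification_def S(2))
        have "v = to_complex x + scl ?C \<i> (to_complex y)"
          by (simp add: v to_complex_def complexification_def)
        then show "v \<in> C.span (to_complex ` S)"
          using em[OF v(2)] em[OF v(3)] by (simp add: C.span_add C.span_scale)
      qed
    qed
    then show "\<exists>S. finite S \<and> C.span S = gr ?C k"
      using S(1) by blast
  next
    fix v :: "'a \<times> 'a"
    obtain x y where v: "v = (x, y)" by fastforce
    let ?P = "\<lambda>c x. (\<forall>k. c k \<in> gr L k) \<and> finite {k. c k \<noteq> 0} \<and> x = (\<Sum>k | c k \<noteq> 0. c k)"
    let ?Q = "\<lambda>c x. (\<forall>k. c k \<in> gr ?C k) \<and> finite {k. c k \<noteq> 0} \<and> x = (\<Sum>k | c k \<noteq> 0. c k)"
    have eq: "?Q c v \<longleftrightarrow> ?P (fst \<circ> c) x \<and> ?P (snd \<circ> c) y" for c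
    proof -
      have set: "{k. c k \<noteq> 0} = {k. fst (c k) \<noteq> 0} \<union> {k. snd (c k) \<noteq> 0}"
        by (auto simp: prod_eq_iff)
      have f: "fst (\<Sum>k\<in>A. c k) = (\<Sum>k\<in>A. fst (c k))"
          "snd (\<Sum>k\<in>A. c k) = (\<Sum>k\<in>A. snd (c k))" for A
        by (simp_all add: fst_sum snd_sum)
      show ?thesis
      proof (cases "finite {k. c k \<noteq> 0}")
        case True
        then have fin: "finite {k. fst (c k) \<noteq> 0}" "finite {k. snd (c k) \<noteq> 0}"
          unfolding set by auto
        have "(\<Sum>k | c k \<noteq> 0. fst (c k)) = (\<Sum>k | fst (c k) \<noteq> 0. fst (c k))"
            "(\<Sum>k | c k \<noteq> 0. snd (c k)) = (\<Sum>k | snd (c k) \<noteq> 0. snd (c k))"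
          by (rule sum.mono_neutral_right[OF True]; auto simp: set)+
        then show ?thesis
          using True fin unfolding set v prod_eq_iff
          by (auto simp: f mem_Times_iff complexification_def set simp del: disj_not1)
      next
        case False
        then show ?thesis using set by (auto)
      qed
    qed
    obtain a b where "?P a x" "?P b y" using gr_direct_sum[of x] gr_direct_sum[of y] by blast
    then have "?Q (\<lambda>k. (a k, b k)) v" unfolding eq by (simp add: o_def)
    moreover have "c = c'" if "?Q c v" "?Q c' v" for c c'
    proof -
      have "fst \<circ> c = fst \<circ> c'" "snd \<circ> c = snd \<circ> c'"
        using that gr_direct_sum[of x] gr_direct_sum[of y] unfolding eq by blast+
      then show ?thesis by (auto simp: fun_eq_iff prod_eq_iff)
    qed
    ultimately show "\<exists>!c. ?Q c v"
      by (intro ex1I[of _ "\<lambda>k. (a k, b k)"]) assumption+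
  next
    fix u v k m assume "u \<in> gr ?C k" "v \<in> gr ?C m"
    then show "brk ?C u v \<in> gr ?C (k + m)"
      using gr_subspace[of "k + m"]
      by (auto simp: complexification_def intro!: subspace_add subspace_diff gr_bracket)
  next
    fix S assume S: "C.subspace S" "\<And>x y. x \<in> S \<Longrightarrow> y \<in> S \<Longrightarrow> brk ?C x y \<in> S" "gr ?C 1 \<subseteq> S"
    have "{x. to_complex x \<in> S} = UNIV"
    proof (rule gr_generated)
      show "subspace {x. to_complex x \<in> S}"
      proof (rule subspaceI; clarsimp)
        show "to_complex 0 \<in> S" using C.subspace_0[OF S(1)] by (simp add: to_complex_def zero_prod_def)
      next
        fix x y assume "to_complex x \<in> S" "to_complex y \<in> S"
        then show "to_complex (x + y) \<in> S"
          using C.subspace_add[OF S(1)] by (fastforce simp: to_complex_def)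
      next
        fix c x assume "to_complex x \<in> S"
        then show "to_complex (scl L c x) \<in> S"
          using C.subspace_scale[OF S(1), of "to_complex x" "of_real c"]
          by (simp add: to_complex_def complexification_def)
      qed
    next
      have z: "brk L x 0 = 0" "brk L 0 x = 0" for x
        using br_diff[of x 0 0] bl_diff[of 0 0 x] by simp_all
      fix x y assume "x \<in> {x. to_complex x \<in> S}" "y \<in> {x. to_complex x \<in> S}"
      then show "brk L x y \<in> {x. to_complex x \<in> S}"
        using S(2)[of "to_complex x" "to_complex y"] by (simp add: to_complex_def complexification_def z)
    next
      show "gr L 1 \<subseteq> {x. to_complex x \<in> S}"
        using S(3) subspace_0[OF gr_subspace[of 1]] by (auto simp: to_complex_def complexification_def)
    qed
    then have all: "to_complex x \<in> S" for x by blast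
    have "(x, y) \<in> S" for x y
    proof -
      have "(x, y) = to_complex x + scl ?C \<i> (to_complex y)"
        by (simp add: to_complex_def complexification_def)
      then show ?thesis using all C.subspace_add[OF S(1)] C.subspace_scale[OF S(1)] by metis
    qed
    then show "S = UNIV" by auto
  qed
qed

end

theory Submission
  imports Defs
begin

text \<open>
  Since the Lie algebra is generated in degree one, every element of degree \<open>p\<close> of the enveloping
  algebra is the class of a combination of words of length \<open>p\<close> in the basis, and its norm is the
  quotient norm of the \<open>l\<^sup>1\<close> norm on the free algebra.  The latter is submultiplicative.
  Rapid decrease means \<open>\<parallel>z\<^sub>p\<parallel> \<le> M e\<^sup>-\<^sup>C\<^sup>p\<close> for every \<open>C\<close> with some \<open>M\<close>; polynomial and exponential
  factors in \<open>p\<close>, which come from convolution, from a change of basis and from counting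
  compositions of \<open>p\<close>, are absorbed by enlarging \<open>C\<close>.  In particular
  \<open>\<parallel>(z\<^sup>m)\<^sub>p\<parallel> \<le> M\<^sup>m 2\<^sup>p e\<^sup>-\<^sup>C\<^sup>p\<close>, which is summable against the coefficients of an entire function.
  A real series is carried to the complexification by a homomorphism that maps words to words
  and so does not increase the norm.
\<close>

section \<open>The enveloping algebra as a quotient\<close>

lemma free_alg_simps [simp]:
  "carrier free_alg = UNIV" "f \<otimes>\<^bsub>free_alg\<^esub> g = f * g" "f \<oplus>\<^bsub>free_alg\<^esub> g = f + g"
  "\<one>\<^bsub>free_alg\<^esub> = 1" "\<zero>\<^bsub>free_alg\<^esub> = 0"
  by (simp_all add: free_alg_def)

lemma a_minus_free_alg: "f \<ominus>\<^bsub>free_alg\<^esub> g = f - (g :: 'a fword \<Rightarrow>\<^sub>0 'k::field)"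
proof -
  interpret ring "free_alg :: ('a fword \<Rightarrow>\<^sub>0 'k) ring" by (rule ring_free_alg)
  have "\<ominus>\<^bsub>free_alg\<^esub> g = - g"
    by (rule minus_equality) auto
  then show ?thesis by (simp add: a_minus_def)
qed

lemma env_class_eq_iff: "env_class L f = env_class L g \<longleftrightarrow> f - g \<in> env_ideal L"
  using ring.quotient_eq_iff_same_a_r_cos[OF ring_free_alg ideal_env_ideal, of f g L]
  by (auto simp: env_class_def a_minus_free_alg)

lemma ring_hom_env_class: "env_class L \<in> ring_hom free_alg (env L)"
  using ideal.rcos_ring_hom[OF ideal_env_ideal, of L]
  by (simp add: env_class_def[abs_def] env_def)

lemma env_class_closed [simp]: "env_class L f \<in> carrier (env L)"
  using ring_hom_closed[OF ring_hom_env_class] by simp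

lemma env_class_add: "env_class L (f + g) = env_class L f \<oplus>\<^bsub>env L\<^esub> env_class L g"
  using ring_hom_add[OF ring_hom_env_class, of f g] by simp

lemma env_class_mult: "env_class L (f * g) = env_class L f \<otimes>\<^bsub>env L\<^esub> env_class L g"
  using ring_hom_mult[OF ring_hom_env_class, of f g] by simp

lemma const_1 [simp]: "const 1 = 1"
  by (simp add: const_def)

lemma env_class_one: "env_class L 1 = \<one>\<^bsub>env L\<^esub>"
  using ring_hom_one[OF ring_hom_env_class, of L] by simp

lemma env_class_zero: "env_class L 0 = \<zero>\<^bsub>env L\<^esub>"
  using ring_hom_zero[OF ring_hom_env_class ring_free_alg ring_env, of L] by simp

lemma env_class_sum:
  assumes "finite A"
  shows "env_class L (\<Sum>i\<in>A. f i) = (\<Oplus>\<^bsub>env L\<^esub>i\<in>A. env_class L (f i))"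
proof -
  interpret U: ring "env L" by (rule ring_env)
  show ?thesis
    using assms by induction (simp_all add: env_class_zero env_class_add)
qed

lemma env_scale_class: "env_scale L c (env_class L f) = env_class L (const c * f)"
  by (simp add: env_scale_def env_class_mult)

lemma env_relations_subset: "env_relations L \<subseteq> env_ideal L"
  unfolding env_ideal_def by (rule ring.genideal_self[OF ring_free_alg]) simp

section \<open>The defining relations as identities of classes\<close>

lemma env_class_letter_add:
  "env_class L (word [x + y]) = env_class L (word [x] + word [y])"
  unfolding env_class_eq_iff
  by (rule subsetD[OF env_relations_subset]) (auto simp: env_relations_def diff_diff_eq)

lemma env_class_letter_scale:
  "env_class L (word [scl L c x]) = env_class L (const c * word [x])"
  unfolding env_class_eq_iff
  by (rule subsetD[OF env_relations_subset]) (auto simp: env_relations_def)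

lemma env_class_letter_bracket:
  "env_class L (word [brk L x y]) = env_class L (word [x] * word [y] - word [y] * word [x])"
  unfolding env_class_eq_iff[of L _ "_ - _"]
proof -
  have "word [x] * word [y] - word [y] * word [x] - word [brk L x y] \<in> env_ideal L"
    by (rule subsetD[OF env_relations_subset]) (auto simp: env_relations_def)
  \<comment> \<open>The relation carries the opposite sign; it is turned around because equality of
    classes is symmetric.\<close>
  then show "word [brk L x y] - (word [x] * word [y] - word [y] * word [x]) \<in> env_ideal L"
    using env_class_eq_iff by metis
qed

section \<open>Monomial expansions in the free algebra\<close>

lemma single_fword: "Poly_Mapping.single w c = const c * word (letters w)"
  by (simp add: const_def word_def mult_single)

lemma word_Cons: "word (x # xs) = word [x] * word xs"
  by (simp add: word_def mult_single plus_fword_def)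

lemma word_Nil: "word [] = 1"
  by (simp add: word_def flip: zero_fword_def single_one)

lemma sum_single_lookup:
  "(\<Sum>w\<in>Poly_Mapping.keys f. Poly_Mapping.single w (Poly_Mapping.lookup f w)) = f"
  by (rule poly_mapping_eqI)
     (auto simp: lookup_sum lookup_single when_def in_keys_iff sum.delta)

text \<open>A product of monomials is a monomial, so estimates and multiplicativity for general
  products can be checked on monomials after this expansion.\<close>

lemma times_eq_sum_single:
  fixes f g :: "'w::monoid_add \<Rightarrow>\<^sub>0 'k::semiring_0"
  shows "f * g = (\<Sum>v\<in>Poly_Mapping.keys f. \<Sum>w\<in>Poly_Mapping.keys g.
    Poly_Mapping.single (v + w) (Poly_Mapping.lookup f v * Poly_Mapping.lookup g w))"
  by (subst (1 2) sum_single_lookup[symmetric]) (simp add: sum_product mult_single)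

section \<open>Homogeneous combinations of basis words\<close>

text \<open>For letters of degree one the length of a word is its degree, so these are the
  representatives over which the norm in degree \<open>p\<close> is an infimum.\<close>

definition word_combs :: "'a set \<Rightarrow> nat \<Rightarrow> ('a fword \<Rightarrow>\<^sub>0 'k::field) set" where
  "word_combs B p = {f. \<forall>w\<in>Poly_Mapping.keys f. letters w \<in> basis_words B p}"

lemma word_combs_0: "0 \<in> word_combs B p"
  by (simp add: word_combs_def)

lemma word_combs_add: "f \<in> word_combs B p \<Longrightarrow> g \<in> word_combs B p \<Longrightarrow> f + g \<in> word_combs B p"
  using Poly_Mapping.keys_add[of f g] by (auto simp: word_combs_def)

lemma word_combs_mult:
  "f \<in> word_combs B p \<Longrightarrow> g \<in> word_combs B q \<Longrightarrow> f * g \<in> word_combs B (p + q)"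
  using Poly_Mapping.keys_mult[of f g]
  by (fastforce simp: word_combs_def basis_words_def plus_fword_def)

lemma word_combs_const: "const c \<in> word_combs B 0"
  by (simp add: word_combs_def const_def basis_words_def zero_fword_def)

lemma word_combs_word: "w \<in> basis_words B p \<Longrightarrow> word w \<in> word_combs B p"
  by (simp add: word_combs_def word_def)

lemma word_combs_sum:
  "(\<And>i. i \<in> A \<Longrightarrow> f i \<in> word_combs B p) \<Longrightarrow> (\<Sum>i\<in>A. f i) \<in> word_combs B p"
  by (induction A rule: infinite_finite_induct) (auto intro: word_combs_0 word_combs_add)

section \<open>The l1 norm on the free algebra\<close>

definition l1_norm :: "('w \<Rightarrow>\<^sub>0 'k::real_normed_field) \<Rightarrow> real" where
  "l1_norm f = (\<Sum>w\<in>Poly_Mapping.keys f. norm (Poly_Mapping.lookup f w))"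

lemma l1_norm_superset:
  "finite A \<Longrightarrow> Poly_Mapping.keys f \<subseteq> A \<Longrightarrow> l1_norm f = (\<Sum>w\<in>A. norm (Poly_Mapping.lookup f w))"
  unfolding l1_norm_def by (rule sum.mono_neutral_left) (auto simp: in_keys_iff)

lemma l1_norm_nonneg: "0 \<le> l1_norm f"
  by (simp add: l1_norm_def sum_nonneg)

lemma l1_norm_0 [simp]: "l1_norm 0 = 0"
  by (simp add: l1_norm_def)

lemma l1_norm_single [simp]: "l1_norm (Poly_Mapping.single w c) = norm c"
  by (simp add: l1_norm_def)

lemma l1_norm_add: "l1_norm (f + g) \<le> l1_norm f + l1_norm g"
proof -
  let ?A = "Poly_Mapping.keys f \<union> Poly_Mapping.keys g"
  have "l1_norm (f + g) = (\<Sum>w\<in>?A. norm (Poly_Mapping.lookup f w + Poly_Mapping.lookup g w))"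
    using Poly_Mapping.keys_add[of f g] by (subst l1_norm_superset[of ?A]) (auto simp: lookup_add)
  also have "\<dots> \<le> (\<Sum>w\<in>?A. norm (Poly_Mapping.lookup f w) + norm (Poly_Mapping.lookup g w))"
    by (rule sum_mono) (rule norm_triangle_ineq)
  also have "\<dots> = l1_norm f + l1_norm g"
    by (simp add: sum.distrib l1_norm_superset[of ?A])
  finally show ?thesis .
qed

lemma l1_norm_sum: "l1_norm (\<Sum>i\<in>A. f i) \<le> (\<Sum>i\<in>A. l1_norm (f i))"
  by (induction A rule: infinite_finite_induct)
     (auto intro: order_trans[OF l1_norm_add])

text \<open>Different pairs of words may concatenate to the same word; by the triangle inequality
  such collisions only lower the norm, and norms of coefficients are multiplicative.\<close>

lemma l1_norm_mult: "l1_norm (f * g) \<le> l1_norm f * l1_norm (g :: 'w::monoid_add \<Rightarrow>\<^sub>0 'k::real_normed_field)"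
proof -
  have "f * g = (\<Sum>v\<in>Poly_Mapping.keys f. \<Sum>w\<in>Poly_Mapping.keys g.
      Poly_Mapping.single (v + w) (Poly_Mapping.lookup f v * Poly_Mapping.lookup g w))"
    by (rule times_eq_sum_single)
  also have "l1_norm \<dots> \<le> (\<Sum>v\<in>Poly_Mapping.keys f. \<Sum>w\<in>Poly_Mapping.keys g.
      l1_norm (Poly_Mapping.single (v + w) (Poly_Mapping.lookup f v * Poly_Mapping.lookup g w)))"
    by (intro order_trans[OF l1_norm_sum] sum_mono l1_norm_sum)
  also have "\<dots> = (\<Sum>v\<in>Poly_Mapping.keys f. \<Sum>w\<in>Poly_Mapping.keys g.
      norm (Poly_Mapping.lookup f v) * norm (Poly_Mapping.lookup g w))"
    by (simp add: norm_mult)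
  also have "\<dots> = l1_norm f * l1_norm g"
    by (simp add: sum_product l1_norm_def)
  finally show ?thesis .
qed

lemma l1_norm_const [simp]: "l1_norm (const c) = norm c"
  by (simp add: const_def)

lemma l1_norm_1 [simp]: "l1_norm (1 :: 'a fword \<Rightarrow>\<^sub>0 'k::real_normed_field) = 1"
  by (subst const_1[symmetric]) (simp del: const_1)

lemma l1_norm_word [simp]: "l1_norm (word w :: _ \<Rightarrow>\<^sub>0 'k::real_normed_field) = 1"
  by (simp add: word_def)

section \<open>Norm bounds by representatives\<close>

text \<open>The infimum defining the norm need not be attained, so bounds are carried by representatives.\<close>

definition env_norm_le ::
    "('k::real_normed_field, 'a::ab_group_add) graded_lie \<Rightarrow> 'a set \<Rightarrow> nat \<Rightarrow> ('a fword \<Rightarrow>\<^sub>0 'k) set \<Rightarrow> real \<Rightarrow> bool" where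
  "env_norm_le L B p u r \<longleftrightarrow> (\<exists>f\<in>word_combs B p. env_class L f = u \<and> l1_norm f \<le> r)"

lemma env_norm_le_nonneg: "env_norm_le L B p u r \<Longrightarrow> 0 \<le> r"
  using l1_norm_nonneg order_trans by (auto simp: env_norm_le_def)

lemma env_norm_le_mono: "env_norm_le L B p u r \<Longrightarrow> r \<le> s \<Longrightarrow> env_norm_le L B p u s"
  by (force simp: env_norm_le_def)

lemma env_norm_le_closed: "env_norm_le L B p u r \<Longrightarrow> u \<in> carrier (env L)"
  by (auto simp: env_norm_le_def)

lemma env_norm_le_0: "env_norm_le L B p \<zero>\<^bsub>env L\<^esub> 0"
  unfolding env_norm_le_def by (rule bexI[OF _ word_combs_0]) (simp add: env_class_zero)

lemma env_norm_le_1: "env_norm_le L B 0 \<one>\<^bsub>env L\<^esub> 1"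
  unfolding env_norm_le_def
  by (rule bexI[of _ 1]) (use word_combs_const[of 1 B] in \<open>simp_all add: env_class_one\<close>)

lemma env_norm_le_add:
  "env_norm_le L B p u r \<Longrightarrow> env_norm_le L B p v s \<Longrightarrow> env_norm_le L B p (u \<oplus>\<^bsub>env L\<^esub> v) (r + s)"
  unfolding env_norm_le_def
  by (force simp: env_class_add intro: word_combs_add order_trans[OF l1_norm_add])

text \<open>Concatenation adds lengths and the l1 norm is submultiplicative, so the product of two
  representatives is a representative with the required bound.\<close>

lemma env_norm_le_mult:
  assumes "env_norm_le L B p u r" "env_norm_le L B q v s"
  shows "env_norm_le L B (p + q) (u \<otimes>\<^bsub>env L\<^esub> v) (r * s)"
proof -
  obtain f g where fg: "f \<in> word_combs B p" "env_class L f = u" "l1_norm f \<le> r"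
    "g \<in> word_combs B q" "env_class L g = v" "l1_norm g \<le> s"
    using assms by (auto simp: env_norm_le_def)
  have "l1_norm (f * g) \<le> r * s"
    by (rule order_trans[OF l1_norm_mult mult_mono])
       (use fg l1_norm_nonneg order_trans in \<open>auto intro: l1_norm_nonneg order_trans\<close>)
  then show ?thesis
    unfolding env_norm_le_def using fg
    by (intro bexI[of _ "f * g"]) (simp_all add: env_class_mult word_combs_mult)
qed

text \<open>A scalar is an element of degree zero represented by a multiple of the empty word, so
  this is a product with \<open>p\<close> split as \<open>0 + p\<close>.\<close>

lemma env_norm_le_scale:
  assumes "env_norm_le L B p u r"
  shows "env_norm_le L B p (env_scale L c u) (norm c * r)"
proof -
  have "env_norm_le L B 0 (env_class L (const c)) (norm c)"
    unfolding env_norm_le_def by (rule bexI[OF _ word_combs_const[of c]]) simp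
  from env_norm_le_mult[OF this assms] show ?thesis
    by (simp add: env_scale_def)
qed

lemma env_norm_le_finsum:
  assumes "finite A" "\<And>i. i \<in> A \<Longrightarrow> env_norm_le L B p (u i) (r i)"
  shows "env_norm_le L B p (\<Oplus>\<^bsub>env L\<^esub>i\<in>A. u i) (\<Sum>i\<in>A. r i)"
proof -
  interpret U: ring "env L" by (rule ring_env)
  show ?thesis
    using assms
  proof (induction A)
    case (insert a A)
    then have "env_norm_le L B p (u a \<oplus>\<^bsub>env L\<^esub> (\<Oplus>\<^bsub>env L\<^esub>i\<in>A. u i)) (r a + (\<Sum>i\<in>A. r i))"
      by (intro env_norm_le_add) auto
    moreover have "u \<in> insert a A \<rightarrow> carrier (env L)"
      using insert.prems env_norm_le_closed by blast
    ultimately show ?case using insert.hyps by simp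
  qed (simp add: env_norm_le_0)
qed

lemma env_norm_le_letter: "b \<in> B \<Longrightarrow> env_norm_le L B 1 (env_class L (word [b])) 1"
  unfolding env_norm_le_def
  by (rule bexI[of _ "word [b]"]) (auto intro: word_combs_word simp: basis_words_def)

text \<open>The letters of \<open>f\<close> may be arbitrary: each word is rewritten in the letters
  of \<open>B\<close> at cost \<open>r w\<close>, and the costs are weighted by the
  coefficients.\<close>

lemma env_norm_le_class:
  assumes "\<And>w. w \<in> Poly_Mapping.keys f \<Longrightarrow> env_norm_le L B p (env_class L (word (letters w))) (r w)"
  shows "env_norm_le L B p (env_class L f)
    (\<Sum>w\<in>Poly_Mapping.keys f. norm (Poly_Mapping.lookup f w) * r w)"
proof -
  have "env_class L f =
      (\<Oplus>\<^bsub>env L\<^esub>w\<in>Poly_Mapping.keys f. env_scale L (Poly_Mapping.lookup f w) (env_class L (word (letters w))))"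
    by (subst sum_single_lookup[symmetric])
       (simp add: env_class_sum single_fword env_scale_class)
  then show ?thesis
    using assms by (auto intro!: env_norm_le_finsum env_norm_le_scale)
qed

text \<open>Rewriting one letter costs a factor of at most \<open>A\<close>, so rewriting a word of
  length \<open>p\<close> costs \<open>A ^ p\<close>.\<close>

lemma env_norm_le_change_basis:
  assumes "env_norm_le L B p u r" and "0 \<le> A"
    and A: "\<And>b. b \<in> B \<Longrightarrow> env_norm_le L B' 1 (env_class L (word [b])) A"
  shows "env_norm_le L B' p u (A ^ p * r)"
proof -
  have word: "env_norm_le L B' p (env_class L (word w)) (A ^ p)" if "w \<in> basis_words B p" for w p
    using that
  proof (induction w arbitrary: p)
    case Nil
    then show ?case by (simp add: basis_words_def word_Nil env_class_one env_norm_le_1)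
  next
    case (Cons b w)
    then have "env_norm_le L B' (1 + length w) (env_class L (word [b] * word w)) (A * A ^ length w)"
      unfolding env_class_mult by (intro env_norm_le_mult A) (auto simp: basis_words_def)
    with Cons.prems show ?case by (auto simp: word_Cons[of b w] basis_words_def)
  qed
  obtain f where f: "f \<in> word_combs B p" "env_class L f = u" "l1_norm f \<le> r"
    using assms(1) by (auto simp: env_norm_le_def)
  have "env_norm_le L B' p u (\<Sum>w\<in>Poly_Mapping.keys f. norm (Poly_Mapping.lookup f w) * A ^ p)"
    using env_norm_le_class[of f L B' p "\<lambda>_. A ^ p"] f word by (auto simp: word_combs_def)
  moreover have "(\<Sum>w\<in>Poly_Mapping.keys f. norm (Poly_Mapping.lookup f w) * A ^ p) \<le> A ^ p * r"
    using f(3) \<open>0 \<le> A\<close>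
    by (simp add: mult.commute[of "A ^ p"] mult_right_mono flip: sum_distrib_right l1_norm_def)
  ultimately show ?thesis by (rule env_norm_le_mono)
qed

section \<open>Generation in degree one\<close>

text \<open>The form in which a basis enters the estimates; it passes to the complexification along
  \<open>to_complex\<close>.\<close>

definition degree_one_spanning :: "('k::field, 'a::ab_group_add) graded_lie \<Rightarrow> 'a set \<Rightarrow> bool" where
  "degree_one_spanning L B \<longleftrightarrow> finite B \<and> Modules.module.span (scl L) B = gr L 1"

lemma degree_one_basis_spanning: "degree_one_basis L B \<Longrightarrow> degree_one_spanning L B"
  by (simp add: degree_one_basis_def degree_one_spanning_def)

lemma env_bounded_add:
  assumes "\<exists>r. env_norm_le L B p (env_class L (word [x])) r"
    and "\<exists>r. env_norm_le L B p (env_class L (word [y])) r"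
  shows "\<exists>r. env_norm_le L B p (env_class L (word [x + y])) r"
  using assms env_norm_le_add unfolding env_class_letter_add env_class_add by blast

lemma env_bounded_scale:
  assumes "\<exists>r. env_norm_le L B p (env_class L (word [x])) r"
  shows "\<exists>r. env_norm_le L B p (env_class L (word [scl L c x])) r"
  using assms env_norm_le_scale unfolding env_class_letter_scale env_scale_class[symmetric] by blast

lemma env_bounded_bracket:
  assumes "\<exists>r. env_norm_le L B p (env_class L (word [x])) r"
    and "\<exists>r. env_norm_le L B q (env_class L (word [y])) r"
  shows "\<exists>r. env_norm_le L B (p + q) (env_class L (word [brk L x y])) r"
proof -
  obtain r s where "env_norm_le L B p (env_class L (word [x])) r"
      "env_norm_le L B q (env_class L (word [y])) s"
    using assms by blast
  \<comment> \<open>The bracket is a commutator. The product in the reverse order has degree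
    \<open>q + p\<close>, and its subtraction is scaling by -1 followed by addition.\<close>
  then have "env_norm_le L B (p + q) (env_class L (word [x] * word [y])) (r * s)"
      "env_norm_le L B (p + q) (env_scale L (-1) (env_class L (word [y] * word [x]))) (norm (-1 :: 'a) * (s * r))"
    unfolding env_class_mult using env_norm_le_mult
    by (blast, subst add.commute) (blast intro: env_norm_le_mult env_norm_le_scale)
  from env_norm_le_add[OF this]
  have "env_norm_le L B (p + q) (env_class L (word [x] * word [y] + const (-1) * (word [y] * word [x])))
      (r * s + norm (-1 :: 'a) * (s * r))"
    by (simp only: env_scale_class env_class_add)
  moreover have "const (-1) * f = - f" for f :: "'b fword \<Rightarrow>\<^sub>0 'a"
    by (simp add: const_def single_uminus)
  ultimately show ?thesis
    unfolding env_class_letter_bracket by auto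
qed

text \<open>The word with the single letter 0 is not the zero of the free algebra; its class
  vanishes by the scaling relation.\<close>

lemma env_bounded_zero:
  assumes "graded_lie_algebra L"
  shows "\<exists>r. env_norm_le L B p (env_class L (word [0])) r"
proof -
  interpret graded_lie_algebra L by fact
  have "env_class L (word [0]) = env_class L (const 0 * word [0])"
    using env_class_letter_scale[of L 0 0] by (simp only: scale_zero_right)
  also have "\<dots> = \<zero>\<^bsub>env L\<^esub>"
    by (simp add: const_def env_class_zero)
  finally show ?thesis using env_norm_le_0 by metis
qed

text \<open>Sums of homogeneous elements that have a representative in basis words form a Lie
  subalgebra containing the first component, hence everything. Uniqueness of the homogeneous
  decomposition then isolates degree \<open>k\<close>.\<close>

lemma env_bounded_homogeneous:
  fixes L :: "('k::real_normed_field, 'a::ab_group_add) graded_lie"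
  assumes "graded_lie_algebra L" and B: "degree_one_spanning L B" and x: "x \<in> gr L k"
  shows "\<exists>r. env_norm_le L B k (env_class L (word [x])) r"
proof -
  interpret graded_lie_algebra L by fact
  define G where "G k = {x \<in> gr L k. \<exists>r. env_norm_le L B k (env_class L (word [x])) r}" for k
  have G: "subspace (G k)" for k
    using gr_subspace[of k]
    by (intro subspaceI)
       (auto simp: G_def subspace_0 subspace_add subspace_scale
         intro!: env_bounded_add env_bounded_scale env_bounded_zero[OF assms(1)])
  note G0 = subspace_0[OF G] and G_add = subspace_add[OF G] and G_scale = subspace_scale[OF G]
  have G_bracket: "brk L x y \<in> G (j + k)" if "x \<in> G j" "y \<in> G k" for x y j k
    using that gr_bracket by (auto simp: G_def intro!: env_bounded_bracket)
  \<comment> \<open>The index set \<open>A\<close> may exceed the support, so that two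
    decompositions can be put over a common one.\<close>
  define S where "S = {x. \<exists>A c. finite A \<and> (\<forall>k. c k \<in> G k) \<and> (\<forall>k. k \<notin> A \<longrightarrow> c k = 0) \<and> x = sum c A}"
  have S_I: "sum c A \<in> S" if "finite A" "\<forall>k. c k \<in> G k" "\<forall>k. k \<notin> A \<longrightarrow> c k = 0" for c A
    unfolding S_def mem_Collect_eq using that by (intro exI[of _ A] exI[of _ c]) simp
  have S_E: thesis
    if "x \<in> S" "\<And>A c. finite A \<Longrightarrow> \<forall>k. c k \<in> G k \<Longrightarrow> \<forall>k. k \<notin> A \<longrightarrow> c k = 0 \<Longrightarrow> x = sum c A \<Longrightarrow> thesis"
    for x thesis
    using that unfolding S_def mem_Collect_eq by (elim exE conjE) (rule that(2))
  have S: "subspace S"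
  proof (rule subspaceI)
    show "0 \<in> S" using S_I[of "{}" "\<lambda>_. 0"] by (simp add: G0)
  next
    fix x y assume x: "x \<in> S" and y: "y \<in> S"
    obtain A c where *: "finite A" "\<forall>k. c k \<in> G k" "\<forall>k. k \<notin> A \<longrightarrow> c k = 0" "x = sum c A"
      using x by (rule S_E)
    obtain A' c' where **: "finite A'" "\<forall>k. c' k \<in> G k" "\<forall>k. k \<notin> A' \<longrightarrow> c' k = 0" "y = sum c' A'"
      using y by (rule S_E)
    have "sum c A = sum c (A \<union> A')" "sum c' A' = sum c' (A \<union> A')"
      using * ** by (auto intro!: sum.mono_neutral_left)
    with * ** have "x + y = (\<Sum>k\<in>A \<union> A'. c k + c' k)"
      by (simp add: sum.distrib)
    moreover have "finite (A \<union> A')" "\<forall>k. c k + c' k \<in> G k" "\<forall>k. k \<notin> A \<union> A' \<longrightarrow> c k + c' k = 0"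
      using * ** by (auto intro: G_add)
    ultimately show "x + y \<in> S"
      using S_I[of "A \<union> A'" "\<lambda>k. c k + c' k"] by simp
  next
    fix a x assume "x \<in> S"
    then obtain A c where *: "finite A" "\<forall>k. c k \<in> G k" "\<forall>k. k \<notin> A \<longrightarrow> c k = 0" "x = sum c A"
      by (rule S_E)
    then have "scl L a x = (\<Sum>k\<in>A. scl L a (c k))" "\<forall>k. scl L a (c k) \<in> G k"
        "\<forall>k. k \<notin> A \<longrightarrow> scl L a (c k) = 0"
      by (simp_all add: scale_sum_right G_scale)
    with *(1) show "scl L a x \<in> S"
      using S_I[of A "\<lambda>k. scl L a (c k)"] by simp
  qed
  have G_S: "G k \<subseteq> S" for k
  proof
    fix x assume "x \<in> G k"
    then show "x \<in> S"
      using S_I[of "{k}" "\<lambda>j. if j = k then x else 0"] by (simp add: G0)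
  qed
  have "S = UNIV"
  proof (rule gr_generated[OF S])
    fix x y assume x: "x \<in> S" and y: "y \<in> S"
    obtain A c where *: "\<forall>k. c k \<in> G k" "x = sum c A"
      using x by (rule S_E)
    obtain A' c' where **: "\<forall>k. c' k \<in> G k" "y = sum c' A'"
      using y by (rule S_E)
    \<comment> \<open>By bilinearity the bracket is a finite sum of terms in
      \<open>G (i + j)\<close>.\<close>
    have "brk L x y = (\<Sum>j\<in>A'. \<Sum>i\<in>A. brk L (c i) (c' j))"
      unfolding *(2) **(2) module_hom.sum[OF bracket_linear_left[folded module_hom_iff_linear], of c A]
      module_hom.sum[OF bracket_linear_right[folded module_hom_iff_linear], of _ c' A'] ..
    also have "\<dots> \<in> S"
      by (intro subspace_sum[OF S] subsetD[OF G_S G_bracket]) (use * ** in auto)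
    finally show "brk L x y \<in> S" .
  next
    have "span B \<subseteq> G 1"
    proof (rule span_minimal[OF _ G])
      show "B \<subseteq> G 1"
        using B env_norm_le_letter span_superset[of B]
        unfolding G_def degree_one_spanning_def by blast
    qed
    then show "gr L 1 \<subseteq> S"
      using B G_S by (auto simp: degree_one_spanning_def)
  qed
  then have "x \<in> S" by simp
  then obtain A c where c: "finite A" "\<forall>k. c k \<in> G k" "\<forall>k. k \<notin> A \<longrightarrow> c k = 0" "x = sum c A"
    by (rule S_E)
  \<comment> \<open>The index set shrinks to the exact support, the form in which uniqueness of the
    decomposition is stated.\<close>
  have sub: "{j. c j \<noteq> 0} \<subseteq> A" using c(3) by auto
  have "finite {j. c j \<noteq> 0}" by (rule finite_subset[OF sub c(1)])
  moreover have "x = (\<Sum>j | c j \<noteq> 0. c j)"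
    unfolding c(4) by (rule sum.mono_neutral_right[OF c(1) sub]) auto
  moreover have "\<forall>j. c j \<in> gr L j" using c(2) by (simp add: G_def)
  \<comment> \<open>A homogeneous \<open>x\<close> also has the decomposition concentrated in degree
    \<open>k\<close>; uniqueness gives \<open>c = d\<close>, hence \<open>x = c k\<close>.\<close>
  moreover define d where "d = (\<lambda>j. if j = k then x else 0)"
  have "{j. d j \<noteq> 0} = (if x = 0 then {} else {k})" by (auto simp: d_def)
  then have "finite {j. d j \<noteq> 0}" "x = (\<Sum>j | d j \<noteq> 0. d j)"
    by (auto simp: d_def)
  moreover have "\<forall>j. d j \<in> gr L j"
    using x subspace_0[OF gr_subspace] by (auto simp: d_def)
  moreover have unique: "a = b" if "\<exists>!c. P c" "P a" "P b" for P and a b :: "nat \<Rightarrow> 'a"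
    using that by blast
  ultimately have "c = d"
    by (intro unique[OF gr_direct_sum[of x]] conjI)
  then have "x \<in> G k" using c(2)[rule_format, of k] by (simp add: d_def)
  then show ?thesis by (simp add: G_def)
qed

text \<open>Letterwise rewriting of products of homogeneous elements. It guarantees that the infimum
  in the norm runs over a nonempty set.\<close>

lemma env_bounded_env_gr:
  assumes "graded_lie_algebra L" "degree_one_spanning L B" "u \<in> env_gr L p"
  shows "\<exists>r. env_norm_le L B p u r"
proof -
  have word: "\<exists>r. env_norm_le L B (sum_list ks) (env_class L (word xs)) r"
    if "list_all2 (\<lambda>x k. x \<in> gr L k) xs ks" for xs ks
    using that
  proof (induction rule: list_all2_induct)
    case Nil
    then show ?case using env_norm_le_1 by (auto simp: word_Nil env_class_one)
  next
    case (Cons x xs k ks)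
    then show ?case
      using env_bounded_homogeneous[OF assms(1,2)] env_norm_le_mult
      unfolding word_Cons[of x xs] env_class_mult sum_list.Cons by blast
  qed
  obtain f where f: "u = env_class L f"
    "\<And>w. w \<in> Poly_Mapping.keys f \<Longrightarrow> \<exists>ks. list_all2 (\<lambda>x k. x \<in> gr L k) (letters w) ks \<and> sum_list ks = p"
    using assms(3) by (auto simp: env_gr_def)
  then have "\<forall>w\<in>Poly_Mapping.keys f. \<exists>r. env_norm_le L B p (env_class L (word (letters w))) r"
    using word by blast
  then obtain r where "\<forall>w\<in>Poly_Mapping.keys f. env_norm_le L B p (env_class L (word (letters w))) (r w)"
    by metis
  then show ?thesis using env_norm_le_class f(1) by blast
qed

text \<open>A word of \<open>p\<close> letters from the first component has degrees 1, ..., 1 with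
  sum \<open>p\<close>.\<close>

lemma env_norm_le_env_gr:
  assumes "B \<subseteq> gr L 1" "env_norm_le L B p u r"
  shows "u \<in> env_gr L p"
proof -
  obtain f where f: "f \<in> word_combs B p" "env_class L f = u"
    using assms(2) by (auto simp: env_norm_le_def)
  have "list_all2 (\<lambda>x k. x \<in> gr L k) (letters w) (replicate p 1) \<and> sum_list (replicate p 1) = p"
    if "w \<in> Poly_Mapping.keys f" for w
    using that f(1) assms(1) nth_mem[of _ "letters w"]
    by (fastforce simp: word_combs_def basis_words_def sum_list_replicate intro!: list_all2_all_nthI)
  then show ?thesis
    using f(2) unfolding env_gr_def by blast
qed

text \<open>Coefficient families on basis words and elements of \<open>word_combs\<close> determine
  each other: \<open>?comb\<close> assembles an element and \<open>lookup\<close> reads its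
  coefficients back.\<close>

lemma env_norm_eq_Inf:
  fixes L :: "('k::real_normed_field, 'a::ab_group_add) graded_lie"
  assumes "finite B"
  shows "env_norm L B p u = Inf {l1_norm f | f. f \<in> word_combs B p \<and> env_class L f = u}"
proof -
  let ?W = "basis_words B p"
  have W: "finite ?W"
    using finite_lists_length_eq[OF assms, of p] by (simp add: basis_words_def conj_commute)
  let ?comb = "\<lambda>c. \<Sum>w\<in>?W. const (c w) * word w"
  have cls: "(\<Oplus>\<^bsub>env L\<^esub>w\<in>?W. env_scale L (c w) (env_class L (word w))) = env_class L (?comb c)" for c
    by (simp add: env_class_sum[OF W] env_scale_class)
  have comb: "?comb c \<in> word_combs B p" for c
    using word_combs_mult[OF word_combs_const word_combs_word] by (fastforce intro: word_combs_sum)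
  have lookup: "Poly_Mapping.lookup (?comb c) (FWord w) = (if w \<in> ?W then c w else 0)" for c w
    using W by (simp add: const_def word_def mult_single lookup_sum lookup_single when_def)
  have l1: "l1_norm f = (\<Sum>w\<in>?W. norm (Poly_Mapping.lookup f (FWord w)))" if "f \<in> word_combs B p"
    for f :: "'a fword \<Rightarrow>\<^sub>0 'k"
  proof -
    have "Poly_Mapping.keys f \<subseteq> FWord ` ?W"
      using that by (force simp: word_combs_def image_iff intro: fword.collapse[symmetric])
    then have "l1_norm f = (\<Sum>w\<in>FWord ` ?W. norm (Poly_Mapping.lookup f w))"
      using W by (intro l1_norm_superset) auto
    then show ?thesis by (simp add: sum.reindex inj_on_def)
  qed
  have eq: "?comb (\<lambda>w. Poly_Mapping.lookup f (FWord w)) = f" if "f \<in> word_combs B p" for f :: "'a fword \<Rightarrow>\<^sub>0 'k"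
  proof (rule poly_mapping_eqI)
    fix w
    have "letters w \<notin> ?W \<Longrightarrow> Poly_Mapping.lookup f w = 0"
      using that by (auto simp: word_combs_def in_keys_iff)
    then show "Poly_Mapping.lookup (?comb (\<lambda>w. Poly_Mapping.lookup f (FWord w))) w = Poly_Mapping.lookup f w"
      unfolding lookup[of _ "letters w", unfolded fword.collapse] by simp
  qed
  have "{\<Sum>w\<in>?W. norm (c w) | c. u = env_class L (?comb c)} =
      {l1_norm f | f. f \<in> word_combs B p \<and> env_class L f = u}"
  proof (intro equalityI subsetI; clarify)
    fix c
    show "\<exists>f. (\<Sum>w\<in>?W. norm (c w)) = l1_norm f \<and> f \<in> word_combs B p \<and> env_class L f = env_class L (?comb c)"
      by (rule exI[of _ "?comb c"]) (simp add: comb l1[OF comb] lookup)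
  next
    fix f :: "'a fword \<Rightarrow>\<^sub>0 'k" assume f: "f \<in> word_combs B p"
    show "\<exists>c. l1_norm f = (\<Sum>w\<in>?W. norm (c w)) \<and> env_class L f = env_class L (?comb c)"
      by (rule exI[of _ "\<lambda>w. Poly_Mapping.lookup f (FWord w)"]) (simp add: eq[OF f] l1[OF f])
  qed
  then show ?thesis by (simp add: env_norm_def cls)
qed

lemma env_norm_le_imp_norm:
  assumes "finite B" "env_norm_le L B p u r"
  shows "env_norm L B p u \<le> r"
proof -
  obtain f where "f \<in> word_combs B p" "env_class L f = u" "l1_norm f \<le> r"
    using assms(2) by (auto simp: env_norm_le_def)
  moreover have "bdd_below {l1_norm f | f. f \<in> word_combs B p \<and> env_class L f = u}"
    by (rule bdd_belowI[of _ 0]) (auto simp: l1_norm_nonneg)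
  ultimately show ?thesis
    unfolding env_norm_eq_Inf[OF assms(1)] by (blast intro: cInf_lower2)
qed

text \<open>Some representative lies strictly below any number above the infimum. The bound
  \<open>r\<close> ensures that representatives exist, without which the infimum says
  nothing.\<close>

lemma env_norm_less_imp_le:
  assumes "finite B" "env_norm_le L B p u r" "env_norm L B p u < s"
  shows "env_norm_le L B p u s"
proof -
  let ?N = "{l1_norm f | f. f \<in> word_combs B p \<and> env_class L f = u}"
  have "?N \<noteq> {}" using assms(2) by (auto simp: env_norm_le_def)
  moreover have "Inf ?N < s" using assms(3) by (simp only: env_norm_eq_Inf[OF assms(1)])
  ultimately have "\<exists>t\<in>?N. t < s" by (rule cInf_lessD)
  then show ?thesis by (auto simp: env_norm_le_def intro: less_imp_le)
qed

text \<open>The bounds on the right also yield the homogeneity of each \<open>z p\<close>, since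
  their representatives are combinations of words of length \<open>p\<close> in letters of degree
  one.\<close>

lemma env_circ_iff:
  assumes "graded_lie_algebra L" and B: "degree_one_spanning L B"
  shows "z \<in> env_circ L B \<longleftrightarrow> (\<forall>C. \<exists>M. \<forall>p. env_norm_le L B p (z p) (M * exp (- (C * real p))))"
    (is "_ \<longleftrightarrow> ?R")
proof
  interpret graded_lie_algebra L by fact
  have fin: "finite B" and sub: "B \<subseteq> gr L 1"
    using B span_superset[of B] by (auto simp: degree_one_spanning_def)
  {
    assume z: "z \<in> env_circ L B"
    show ?R
    proof
      fix C :: real
      obtain M where M: "env_norm L B p (z p) * exp (C * real p) \<le> M" for p
        using z by (auto simp: env_circ_def bdd_above_def)
      have "env_norm_le L B p (z p) ((M + 1) * exp (- (C * real p)))" for p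
      proof -
        obtain r where r: "env_norm_le L B p (z p) r"
          using z env_bounded_env_gr[OF assms] by (fastforce simp: env_circ_def env_bar_def)
        \<comment> \<open>Adding 1 makes the inequality strict, as a possibly unattained infimum
          demands.\<close>
        have "env_norm L B p (z p) * exp (C * real p) < M + 1"
          using M[of p] by simp
        then have "env_norm L B p (z p) < (M + 1) * exp (- (C * real p))"
          by (simp add: exp_minus field_simps)
        then show ?thesis by (rule env_norm_less_imp_le[OF fin r])
      qed
      then show "\<exists>M. \<forall>p. env_norm_le L B p (z p) (M * exp (- (C * real p)))" by blast
    qed
  next
    assume R: ?R
    have "z \<in> carrier (env_bar L)"
      using R env_norm_le_env_gr[OF sub] by (fastforce simp: env_bar_def)
    moreover have "bdd_above (range (\<lambda>p. env_norm L B p (z p) * exp (C * real p)))" for C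
    proof -
      obtain M where "env_norm_le L B p (z p) (M * exp (- (C * real p)))" for p
        using R by blast
      then have "env_norm L B p (z p) \<le> M * exp (- (C * real p))" for p
        using env_norm_le_imp_norm[OF fin] by blast
      then have "env_norm L B p (z p) * exp (C * real p) \<le> M" for p
        by (simp add: exp_minus field_simps)
      then show ?thesis by (intro bdd_aboveI[of _ M]) auto
    qed
    ultimately show "z \<in> env_circ L B" by (simp add: env_circ_def)
  }
qed

section \<open>Products and powers of rapidly decreasing series\<close>

lemma env_bar_mult_nth:
  "(z \<otimes>\<^bsub>env_bar L\<^esub> u) p = (\<Oplus>\<^bsub>env L\<^esub>k\<in>{..p}. z k \<otimes>\<^bsub>env L\<^esub> u (p - k))"
  by (simp add: env_bar_def)

lemma env_norm_le_bar_mult: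
  assumes "\<And>k. k \<le> p \<Longrightarrow> env_norm_le L B k (z k) (r k)"
    and "\<And>k. k \<le> p \<Longrightarrow> env_norm_le L B k (u k) (s k)"
  shows "env_norm_le L B p ((z \<otimes>\<^bsub>env_bar L\<^esub> u) p) (\<Sum>k\<le>p. r k * s (p - k))"
  unfolding env_bar_mult_nth
proof (rule env_norm_le_finsum)
  fix k assume "k \<in> {..p}"
  then show "env_norm_le L B p (z k \<otimes>\<^bsub>env L\<^esub> u (p - k)) (r k * s (p - k))"
    using env_norm_le_mult[OF assms(1)[of k] assms(2)[of "p - k"]] by simp
qed simp

text \<open>With rate \<open>C + 1\<close> for both factors, each of the \<open>p + 1\<close>
  convolution terms is bounded by \<open>M * N * exp (- ((C + 1) * real p))\<close>, and
  \<open>p + 1 \<le> exp p\<close> restores the rate \<open>C\<close>.\<close>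

lemma env_circ_mult:
  assumes "graded_lie_algebra L" "degree_one_spanning L B"
    and "z \<in> env_circ L B" "u \<in> env_circ L B"
  shows "z \<otimes>\<^bsub>env_bar L\<^esub> u \<in> env_circ L B"
  unfolding env_circ_iff[OF assms(1,2)]
proof
  fix C :: real
  obtain M N where M: "\<And>p. env_norm_le L B p (z p) (M * exp (- ((C + 1) * real p)))"
    and N: "\<And>p. env_norm_le L B p (u p) (N * exp (- ((C + 1) * real p)))"
    using assms(3,4) unfolding env_circ_iff[OF assms(1,2)] by blast
  \<comment> \<open>In degree zero the exponential is 1, so the bounds there are \<open>M\<close>
    and \<open>N\<close> themselves.\<close>
  have "0 \<le> M" "0 \<le> N"
    using M[of 0] N[of 0] env_norm_le_nonneg by fastforce+
  have "env_norm_le L B p ((z \<otimes>\<^bsub>env_bar L\<^esub> u) p) (M * N * exp (- (C * real p)))" for p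
  proof (rule env_norm_le_mono[OF env_norm_le_bar_mult[OF M N]])
    have "(\<Sum>k\<le>p. M * exp (- ((C + 1) * real k)) * (N * exp (- ((C + 1) * real (p - k))))) =
        (\<Sum>k\<le>p. M * N * exp (- ((C + 1) * real p)))"
    proof (rule sum.cong[OF refl])
      fix k assume "k \<in> {..p}"
      then have "- ((C + 1) * real k) + - ((C + 1) * real (p - k)) = - ((C + 1) * real p)"
        by (simp add: algebra_simps)
      then show "M * exp (- ((C + 1) * real k)) * (N * exp (- ((C + 1) * real (p - k)))) =
          M * N * exp (- ((C + 1) * real p))"
        by (metis exp_add mult.assoc mult.left_commute)
    qed
    also have "\<dots> = M * N * (real p + 1) * exp (- ((C + 1) * real p))"
      by simp
    also have "\<dots> \<le> M * N * exp (real p) * exp (- ((C + 1) * real p))"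
      using exp_ge_add_one_self[of "real p"] \<open>0 \<le> M\<close> \<open>0 \<le> N\<close>
      by (intro mult_right_mono mult_left_mono) (simp_all add: add.commute)
    also have "\<dots> = M * N * exp (- (C * real p))"
      by (simp add: algebra_simps flip: exp_add)
    finally show "(\<Sum>k\<le>p. M * exp (- ((C + 1) * real k)) * (N * exp (- ((C + 1) * real (p - k)))))
        \<le> M * N * exp (- (C * real p))" .
  qed
  then show "\<exists>M. \<forall>p. env_norm_le L B p ((z \<otimes>\<^bsub>env_bar L\<^esub> u) p) (M * exp (- (C * real p)))"
    by blast
qed

text \<open>A change of letters costs a factor exponential in \<open>p\<close>, which a larger rate
  absorbs. Exchanging \<open>B\<close> and \<open>B'\<close> gives equality.\<close>

lemma env_circ_subset:
  assumes L: "graded_lie_algebra L" and B: "degree_one_spanning L B" and B': "degree_one_spanning L B'"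
  shows "env_circ L B \<subseteq> env_circ L B'"
proof
  interpret graded_lie_algebra L by fact
  fix z assume z: "z \<in> env_circ L B"
  have "B \<subseteq> gr L 1" "finite B"
    using B span_superset[of B] by (auto simp: degree_one_spanning_def)
  then have "\<forall>b\<in>B. \<exists>r. env_norm_le L B' 1 (env_class L (word [b])) r"
    using env_bounded_homogeneous[OF L B'] by blast
  then obtain r where r: "\<And>b. b \<in> B \<Longrightarrow> env_norm_le L B' 1 (env_class L (word [b])) (r b)"
    by metis
  \<comment> \<open>The sum of nonnegative costs dominates each of them. The common cost is taken as
    \<open>exp D\<close>, so that its \<open>p\<close>-th power cancels against the extra rate
    \<open>D\<close>.\<close>
  define D where "D = (\<Sum>b\<in>B. r b)"
  have D: "env_norm_le L B' 1 (env_class L (word [b])) (exp D)" if "b \<in> B" for b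
  proof (rule env_norm_le_mono[OF r[OF that]])
    have "r b \<le> D"
      unfolding D_def using r env_norm_le_nonneg \<open>finite B\<close> that by (intro member_le_sum) blast+
    then show "r b \<le> exp D" using exp_ge_add_one_self[of D] by linarith
  qed
  show "z \<in> env_circ L B'"
    unfolding env_circ_iff[OF L B']
  proof
    fix C :: real
    obtain M where M: "\<And>p. env_norm_le L B p (z p) (M * exp (- ((C + D) * real p)))"
      using z unfolding env_circ_iff[OF L B] by blast
    have "exp D ^ p * exp (- ((C + D) * real p)) = exp (- (C * real p))" for p
      by (simp add: algebra_simps flip: exp_of_nat_mult exp_add)
    then have "exp D ^ p * (M * exp (- ((C + D) * real p))) = M * exp (- (C * real p))" for p
      by (metis mult.left_commute)
    then have "env_norm_le L B' p (z p) (M * exp (- (C * real p)))" for p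
      using env_norm_le_change_basis[OF M[of p] exp_ge_zero D] by (simp only:)
    then show "\<exists>M. \<forall>p. env_norm_le L B' p (z p) (M * exp (- (C * real p)))"
      by blast
  qed
qed

text \<open>
  Only indices \<open>k \<ge> 1\<close> contribute to \<open>z\<close>, and there are at most \<open>2\<^sup>p\<close> compositions of \<open>p\<close>.
\<close>

lemma env_norm_le_pow:
  assumes z: "\<And>p. env_norm_le L B p (z p) (M * exp (- (C * real p)))" and z0: "z 0 = \<zero>\<^bsub>env L\<^esub>"
  shows "env_norm_le L B p ((z [^]\<^bsub>env_bar L\<^esub> m) p) (M ^ m * 2 ^ p * exp (- (C * real p)))"
proof (induction m arbitrary: p)
  case 0
  \<comment> \<open>The zeroth power is the unit series, and in degree zero the claimed bound is
    exactly 1.\<close>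
  have "env_norm_le L B p (if p = 0 then \<one>\<^bsub>env L\<^esub> else \<zero>\<^bsub>env L\<^esub>) (if p = 0 then 1 else 0)"
    by (simp add: env_norm_le_0 env_norm_le_1)
  then have "env_norm_le L B p (if p = 0 then \<one>\<^bsub>env L\<^esub> else \<zero>\<^bsub>env L\<^esub>) (2 ^ p * exp (- (C * real p)))"
    by (rule env_norm_le_mono) simp
  then show ?case by (simp add: nat_pow_def env_bar_def)
next
  case (Suc m)
  have "0 \<le> M" using env_norm_le_nonneg[OF z[of 0]] by simp
  \<comment> \<open>The value 0 at index 0 removes the term \<open>k = p\<close> from the
    convolution. What remains is the sum of \<open>2 ^ k\<close> over \<open>k < p\<close>, which is
    \<open>2 ^ p - 1\<close>; with that term the induction would not close.\<close>
  define s where "s k = (if k = 0 then 0 else M * exp (- (C * real k)))" for k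
  have "env_norm_le L B k (z k) (s k)" for k
    using z z0 env_norm_le_0 by (auto simp: s_def)
  from env_norm_le_bar_mult[OF Suc.IH this]
  have "env_norm_le L B p ((z [^]\<^bsub>env_bar L\<^esub> Suc m) p)
      (\<Sum>k\<le>p. M ^ m * 2 ^ k * exp (- (C * real k)) * s (p - k))"
    by (simp add: nat_pow_def)
  moreover have "(\<Sum>k\<le>p. M ^ m * 2 ^ k * exp (- (C * real k)) * s (p - k)) \<le> M ^ Suc m * 2 ^ p * exp (- (C * real p))"
  proof -
    have "(\<Sum>k\<le>p. M ^ m * 2 ^ k * exp (- (C * real k)) * s (p - k)) =
        (\<Sum>k<p. M ^ m * 2 ^ k * exp (- (C * real k)) * s (p - k))"
      by (simp add: s_def lessThan_Suc_atMost[symmetric])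
    also have "\<dots> = (\<Sum>k<p. M ^ Suc m * exp (- (C * real p)) * 2 ^ k)"
    proof (rule sum.cong[OF refl])
      fix k assume "k \<in> {..<p}"
      then have "exp (- (C * real k)) * exp (- (C * real (p - k))) = exp (- (C * real p))"
        by (simp add: algebra_simps flip: exp_add)
      then show "M ^ m * 2 ^ k * exp (- (C * real k)) * s (p - k) = M ^ Suc m * exp (- (C * real p)) * 2 ^ k"
        using \<open>k \<in> {..<p}\<close> by (simp add: s_def)
    qed
    also have "\<dots> = M ^ Suc m * exp (- (C * real p)) * (2 ^ p - 1)"
      by (simp add: power_diff_1_eq[of "2::real"] flip: sum_distrib_left)
    also have "\<dots> \<le> M ^ Suc m * exp (- (C * real p)) * 2 ^ p"
      using \<open>0 \<le> M\<close> by (intro mult_left_mono) auto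
    finally show ?thesis by (simp only: mult_ac)
  qed
  ultimately show ?case by (rule env_norm_le_mono)
qed

text \<open>With rate \<open>C + 1\<close> the factor \<open>2 ^ p \<le> exp p\<close> is absorbed,
  and the sum over \<open>m \<le> p\<close> is bounded uniformly in \<open>p\<close> by the full
  series at \<open>M\<close>. Since \<open>M\<close> depends on \<open>C\<close>, summability is
  required at every radius.\<close>

lemma env_circ_apply:
  assumes L: "graded_lie_algebra L" and B: "degree_one_spanning L B"
    and z: "z \<in> env_circ_plus L B"
    and a: "\<And>r::real. 0 \<le> r \<Longrightarrow> summable (\<lambda>m. norm (a m) * r ^ m)"
  shows "env_apply L a z \<in> env_circ L B"
  unfolding env_circ_iff[OF L B]
proof
  fix C :: real
  have z0: "z 0 = \<zero>\<^bsub>env L\<^esub>" using z by (simp add: env_circ_plus_def)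
  obtain M where M: "\<And>p. env_norm_le L B p (z p) (M * exp (- ((C + 1) * real p)))"
    using z env_circ_iff[OF L B, of z] unfolding env_circ_plus_def by blast
  have "0 \<le> M" using env_norm_le_nonneg[OF M[of 0]] by simp
  define S where "S = suminf (\<lambda>m. norm (a m) * M ^ m)"
  have "env_norm_le L B p (env_apply L a z p) (S * exp (- (C * real p)))" for p
  proof -
    have "env_norm_le L B p (env_apply L a z p)
        (\<Sum>m\<le>p. norm (a m) * (M ^ m * 2 ^ p * exp (- ((C + 1) * real p))))"
      unfolding env_apply_def
      by (intro env_norm_le_finsum env_norm_le_scale env_norm_le_pow M z0) simp
    moreover have "(\<Sum>m\<le>p. norm (a m) * (M ^ m * 2 ^ p * exp (- ((C + 1) * real p)))) \<le> S * exp (- (C * real p))"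
    proof -
      have "2 ^ p * exp (- ((C + 1) * real p)) \<le> exp 1 ^ p * exp (- ((C + 1) * real p))"
        using exp_ge_add_one_self[of 1] by (intro mult_right_mono power_mono) auto
      also have "\<dots> = exp (- (C * real p))"
        by (simp add: algebra_simps flip: exp_of_nat_mult exp_add)
      finally have *: "2 ^ p * exp (- ((C + 1) * real p)) \<le> exp (- (C * real p))" .
      have "(\<Sum>m\<le>p. norm (a m) * (M ^ m * 2 ^ p * exp (- ((C + 1) * real p)))) =
          (\<Sum>m\<le>p. norm (a m) * M ^ m) * (2 ^ p * exp (- ((C + 1) * real p)))"
        unfolding sum_distrib_right by (intro sum.cong refl) (simp only: mult_ac)
      also have "\<dots> \<le> S * exp (- (C * real p))"
        unfolding S_def
        by (intro mult_mono * sum_le_suminf a suminf_nonneg) (use \<open>0 \<le> M\<close> a in auto)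
      finally show ?thesis .
    qed
    ultimately show ?thesis by (rule env_norm_le_mono)
  qed
  then show "\<exists>M. \<forall>p. env_norm_le L B p (env_apply L a z p) (M * exp (- (C * real p)))"
    by blast
qed

section \<open>Absolute summability of the coefficients\<close>

lemma summable_norm_entire:
  fixes a :: "nat \<Rightarrow> complex"
  assumes "\<forall>\<xi>. (\<lambda>m. a m * \<xi> ^ m) sums f \<xi>" and "0 \<le> r"
  shows "summable (\<lambda>m. norm (a m) * r ^ m)"
proof -
  \<comment> \<open>Convergence at a point of modulus greater than \<open>r\<close> gives absolute
    convergence at \<open>r\<close>.\<close>
  have "summable (\<lambda>m. a m * of_real (r + 1) ^ m)"
    using assms(1) sums_summable by blast
  then have "summable (\<lambda>m. norm (a m * of_real r ^ m))"
    by (rule powser_insidea) (use assms(2) in \<open>simp del: of_real_add\<close>)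
  then show ?thesis using assms(2) by (simp add: norm_mult norm_power)
qed

lemma summable_norm_exp_coeffs:
  "summable (\<lambda>m. norm (1 / fact m :: 'k::{real_normed_field}) * r ^ m)"
  using summable_exp[of r] by (simp add: norm_divide inverse_eq_divide)

section \<open>Complexification\<close>

text \<open>Over a common finite index set the map is visibly additive; words outside the support
  contribute zero.\<close>

lemma free_to_complex_superset:
  assumes "finite A" "Poly_Mapping.keys f \<subseteq> A"
  shows "free_to_complex f =
    (\<Sum>w\<in>A. Poly_Mapping.single (FWord (map to_complex (letters w))) (of_real (Poly_Mapping.lookup f w)))"
  unfolding free_to_complex_def single_fword fword.sel
  by (rule sum.mono_neutral_left) (use assms in \<open>auto simp: in_keys_iff const_def\<close>)

lemma free_to_complex_add: "free_to_complex (f + g) = free_to_complex f + free_to_complex g"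
proof -
  let ?A = "Poly_Mapping.keys f \<union> Poly_Mapping.keys g"
  show ?thesis
    using Poly_Mapping.keys_add[of f g]
    by (simp add: free_to_complex_superset[of ?A] lookup_add single_add sum.distrib)
qed

lemma free_to_complex_single:
  "free_to_complex (Poly_Mapping.single w c) =
    Poly_Mapping.single (FWord (map to_complex (letters w))) (of_real c)"
  by (subst free_to_complex_superset[of "{w}"]) simp_all

lemma free_to_complex_0: "free_to_complex 0 = 0"
  by (simp add: free_to_complex_def)

lemma free_to_complex_sum: "free_to_complex (\<Sum>i\<in>A. f i) = (\<Sum>i\<in>A. free_to_complex (f i))"
  by (induction A rule: infinite_finite_induct) (simp_all add: free_to_complex_0 free_to_complex_add)

lemma free_to_complex_diff: "free_to_complex (f - g) = free_to_complex f - free_to_complex g"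
  using free_to_complex_add[of "f - g" g] by (simp add: algebra_simps)

lemma free_to_complex_mult: "free_to_complex (f * g) = free_to_complex f * free_to_complex g"
  unfolding times_eq_sum_single[of f g]
  by (simp add: free_to_complex_sum free_to_complex_single free_to_complex_superset[OF _ order_refl]
      sum_product mult_single plus_fword_def)

lemma free_to_complex_word: "free_to_complex (word xs) = word (map to_complex xs)"
  by (simp add: word_def free_to_complex_single)

lemma free_to_complex_const: "free_to_complex (const c) = const (of_real c)"
  by (simp add: const_def free_to_complex_single zero_fword_def)

lemma free_to_complex_1: "free_to_complex 1 = 1"
  using free_to_complex_const[of 1] by simp

text \<open>The map \<open>to_complex\<close> is real linear and preserves brackets, so each
  defining relation goes to one of the same kind.\<close>

lemma env_class_free_to_complex_relation:
  assumes L: "graded_lie_algebra L" and f: "f \<in> env_relations L"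
  shows "env_class (complexification L) (free_to_complex f) = \<zero>\<^bsub>env (complexification L)\<^esub>"
proof -
  interpret graded_lie_algebra L by fact
  let ?LC = "complexification L"
  have zero: "env_class ?LC (g - h) = \<zero>\<^bsub>env ?LC\<^esub>" if "env_class ?LC g = env_class ?LC h" for g h
    using that env_class_eq_iff[of ?LC g h] env_class_eq_iff[of ?LC "g - h" 0] by (simp add: env_class_zero)
  have brk0: "brk L x 0 = 0" "brk L 0 x = 0" for x
    using module_hom.zero[OF bracket_linear_left[folded module_hom_iff_linear]]
      module_hom.zero[OF bracket_linear_right[folded module_hom_iff_linear]] by auto
  have tc: "to_complex (x + y) = to_complex x + to_complex y"
      "to_complex (scl L c x) = scl ?LC (of_real c) (to_complex x)"
      "to_complex (brk L x y) = brk ?LC (to_complex x) (to_complex y)" for x y c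
    by (simp_all add: to_complex_def complexification_def brk0)
  consider (add) x y where "f = word [x + y] - word [x] - word [y]"
    | (scale) c x where "f = word [scl L c x] - const c * word [x]"
    | (bracket) x y where "f = word [x] * word [y] - word [y] * word [x] - word [brk L x y]"
    using f by (auto simp: env_relations_def)
  then show ?thesis
  proof cases
    case add
    then show ?thesis
      using zero[OF env_class_letter_add[of ?LC "to_complex x" "to_complex y"]]
      by (simp add: free_to_complex_diff free_to_complex_add free_to_complex_word tc diff_diff_eq)
  next
    case scale
    then show ?thesis
      using zero[OF env_class_letter_scale[of ?LC "of_real c" "to_complex x"]]
      by (simp add: free_to_complex_diff free_to_complex_word free_to_complex_mult free_to_complex_const tc)
  next
    case bracket
    then show ?thesis
      using zero[OF env_class_letter_bracket[of ?LC "to_complex x" "to_complex y", symmetric]]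
      by (simp add: free_to_complex_diff free_to_complex_word free_to_complex_mult tc)
  qed
qed

text \<open>Independence of the representative: the kernel of \<open>?h\<close> is an ideal
  containing the relations, hence contains \<open>env_ideal L\<close>.\<close>

lemma env_to_complex_class:
  assumes "graded_lie_algebra L"
  shows "env_to_complex L (env_class L f) = env_class (complexification L) (free_to_complex f)"
proof -
  let ?LC = "complexification L"
  let ?h = "\<lambda>f. env_class ?LC (free_to_complex f)"
  interpret U: ring "env ?LC" by (rule ring_env)
  have "ring_hom_ring free_alg (env ?LC) ?h"
    by (intro ring_hom_ringI2 ring_free_alg ring_env ring_hom_memI)
       (simp_all add: free_to_complex_mult free_to_complex_add free_to_complex_1 env_class_mult
         env_class_add env_class_one)
  then have "ideal (a_kernel free_alg (env ?LC) ?h) free_alg"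
    by (rule ring_hom_ring.kernel_is_ideal)
  moreover have "env_relations L \<subseteq> a_kernel free_alg (env ?LC) ?h"
    using env_class_free_to_complex_relation[OF assms] by (auto simp: a_kernel_def')
  ultimately have "env_ideal L \<subseteq> a_kernel free_alg (env ?LC) ?h"
    unfolding env_ideal_def by (rule ring.genideal_minimal[OF ring_free_alg])
  then have "?h i = \<zero>\<^bsub>env ?LC\<^esub>" if "i \<in> env_ideal L" for i
    using that by (auto simp: a_kernel_def')
  moreover have "env_class L f = {i + f | i. i \<in> env_ideal L}"
    by (auto simp: env_class_def a_r_coset_def')
  \<comment> \<open>This makes the class nonempty, so the union of equal sets over it is that one
    set.\<close>
  moreover have "0 \<in> env_ideal L"
    using env_class_eq_iff[of L 0 0] by simp
  moreover have "?h (i + f) = ?h i \<oplus>\<^bsub>env ?LC\<^esub> ?h f" for i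
    by (simp add: free_to_complex_add env_class_add)
  ultimately have "\<And>g. g \<in> env_class L f \<Longrightarrow> ?h g = ?h f" "env_class L f \<noteq> {}"
    by auto
  then show ?thesis
    unfolding env_to_complex_def by (simp cong: SUP_cong)
qed

text \<open>Words go to words of the same length and real coefficients keep their absolute value;
  the triangle inequality does the rest.\<close>

lemma env_norm_le_to_complex:
  assumes "graded_lie_algebra L" "env_norm_le L B p u r"
  shows "env_norm_le (complexification L) (to_complex ` B) p (env_to_complex L u) r"
proof -
  obtain f where f: "f \<in> word_combs B p" "env_class L f = u" "l1_norm f \<le> r"
    using assms(2) by (auto simp: env_norm_le_def)
  have "free_to_complex f \<in> word_combs (to_complex ` B) p"
    unfolding free_to_complex_def using f(1)
    by (intro word_combs_sum word_combs_mult[OF word_combs_const word_combs_word, simplified])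
       (auto simp: word_combs_def basis_words_def)
  moreover have "l1_norm (free_to_complex f) \<le> r"
    using f(3) l1_norm_sum by (subst free_to_complex_superset[OF _ order_refl])
      (auto simp: l1_norm_def[of f] intro: order_trans[OF l1_norm_sum])
  ultimately show ?thesis
    using f(2) env_to_complex_class[OF assms(1), of f] by (auto simp: env_norm_le_def)
qed

section \<open>Transfer of rapidly decreasing series to the complexification\<close>

lemma degree_one_spanning_complexification:
  assumes "graded_lie_algebra L" "degree_one_spanning L B"
  shows "degree_one_spanning (complexification L) (to_complex ` B)"
proof -
  interpret graded_lie_algebra L by fact
  let ?LC = "complexification L"
  interpret C: graded_lie_algebra ?LC by (rule graded_lie_algebra_complexification) fact
  have B: "finite B" "span B = gr L 1" using assms(2) by (simp_all add: degree_one_spanning_def)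
  have em: "to_complex x \<in> C.span (to_complex ` B)" if "x \<in> span B" for x
    using that
  proof (induction rule: span_induct_alt)
    case base
    show ?case using C.span_zero by (simp add: to_complex_def zero_prod_def)
  next
    case (step c x y)
    have "to_complex (scl L c x + y) = scl ?LC (of_real c) (to_complex x) + to_complex y"
      by (simp add: to_complex_def complexification_def)
    then show ?case
      using step by (simp add: C.span_add C.span_base C.span_scale)
  qed
  have "C.span (to_complex ` B) = gr ?LC 1"
  proof
    show "C.span (to_complex ` B) \<subseteq> gr ?LC 1"
      using B(2) span_base[of _ B] subspace_0[OF gr_subspace[of 1]]
      by (intro C.span_minimal C.gr_subspace) (auto simp: complexification_def to_complex_def)
    show "gr ?LC 1 \<subseteq> C.span (to_complex ` B)"
    proof
      fix v assume "v \<in> gr ?LC 1"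
      then obtain x y where v: "v = (x, y)" "x \<in> span B" "y \<in> span B"
        by (auto simp: complexification_def B(2))
      \<comment> \<open>Both real coordinates lie in the embedded real span, and a complex span is
        closed under multiplication by the imaginary unit.\<close>
      have "v = to_complex x + scl ?LC \<i> (to_complex y)"
        by (simp add: v to_complex_def complexification_def)
      then show "v \<in> C.span (to_complex ` B)"
        using em[OF v(2)] em[OF v(3)] by (simp add: C.span_add C.span_scale)
    qed
  qed
  then show ?thesis
    using B(1) by (simp add: degree_one_spanning_def)
qed

lemma env_circ_plus_to_complex:
  assumes L: "graded_lie_algebra L" and B: "degree_one_spanning L B" and z: "z \<in> env_circ_plus L B"
  shows "(\<lambda>p. env_to_complex L (z p)) \<in> env_circ_plus (complexification L) (to_complex ` B)"
proof -
  \<comment> \<open>The zero in degree zero is written as a class, because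
    \<open>env_to_complex\<close> is computed on classes.\<close>
  have "z \<in> env_circ L B" and z0: "z 0 = env_class L 0"
    using z by (simp_all add: env_circ_plus_def env_class_zero)
  then have "(\<lambda>p. env_to_complex L (z p)) \<in> env_circ (complexification L) (to_complex ` B)"
    unfolding env_circ_iff[OF L B]
      env_circ_iff[OF graded_lie_algebra_complexification[OF L] degree_one_spanning_complexification[OF L B]]
    by (meson env_norm_le_to_complex[OF L])
  moreover have "env_to_complex L (z 0) = \<zero>\<^bsub>env (complexification L)\<^esub>"
    unfolding z0 env_to_complex_class[OF L] by (simp add: free_to_complex_0 env_class_zero)
  ultimately show ?thesis
    by (simp add: env_circ_plus_def)
qed

theorem proposition4p3:
  fixes L :: "(real, 'a::ab_group_add) graded_lie"
  assumes "graded_lie_algebra L"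
  defines "LC \<equiv> complexification L"
  shows
    "((\<forall>B z u. degree_one_basis L B \<and> z \<in> env_circ L B \<and> u \<in> env_circ L B \<longrightarrow>
         z \<otimes>\<^bsub>env_bar L\<^esub> u \<in> env_circ L B) \<and>
      (\<forall>B z u. degree_one_basis LC B \<and> z \<in> env_circ LC B \<and> u \<in> env_circ LC B \<longrightarrow>
         z \<otimes>\<^bsub>env_bar LC\<^esub> u \<in> env_circ LC B)) \<and>
     ((\<forall>B B'. degree_one_basis L B \<and> degree_one_basis L B' \<longrightarrow> env_circ L B = env_circ L B') \<and>
      (\<forall>B B'. degree_one_basis LC B \<and> degree_one_basis LC B' \<longrightarrow> env_circ LC B = env_circ LC B')) \<and>
     ((\<forall>B z f a. degree_one_basis L B \<and> z \<in> env_circ_plus L B \<and>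
         f holomorphic_on UNIV \<and> (\<forall>\<xi>. (\<lambda>m. a m * \<xi> ^ m) sums f \<xi>) \<longrightarrow>
         env_apply LC a (\<lambda>p. env_to_complex L (z p)) \<in> env_circ LC (to_complex ` B)) \<and>
      (\<forall>B z f a. degree_one_basis L B \<and> z \<in> env_circ_plus L B \<and>
         f holomorphic_on UNIV \<and> (\<forall>\<xi>::complex. (\<lambda>m. of_real (a m) * \<xi> ^ m) sums f \<xi>) \<longrightarrow>
         env_apply L a z \<in> env_circ L B) \<and>
      (\<forall>B z f a. degree_one_basis LC B \<and> z \<in> env_circ_plus LC B \<and>
         f holomorphic_on UNIV \<and> (\<forall>\<xi>. (\<lambda>m. a m * \<xi> ^ m) sums f \<xi>) \<longrightarrow>
         env_apply LC a z \<in> env_circ LC B)) \<and>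
     ((\<forall>B z. degree_one_basis L B \<and> z \<in> env_circ_plus L B \<longrightarrow> env_exp L z \<in> env_circ L B) \<and>
      (\<forall>B z. degree_one_basis LC B \<and> z \<in> env_circ_plus LC B \<longrightarrow> env_exp LC z \<in> env_circ LC B))"
proof -
  have L: "graded_lie_algebra L" and LC: "graded_lie_algebra LC"
    using assms graded_lie_algebra_complexification by auto
  note spanning = degree_one_basis_spanning
  \<comment> \<open>Stated for any normed scalar field, so that it applies to both the real algebra
    and its complexification.\<close>
  have change: "env_circ L' B = env_circ L' B'"
    if "graded_lie_algebra L'" "degree_one_basis L' B" "degree_one_basis L' B'"
    for L' :: "('k::real_normed_field, 'b::ab_group_add) graded_lie" and B B'
    using that by (intro equalityI env_circ_subset spanning)
  have exp: "env_exp L' z \<in> env_circ L' B"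
    if "graded_lie_algebra L'" "degree_one_basis L' B" "z \<in> env_circ_plus L' B"
    for L' :: "('k::real_normed_field, 'b::ab_group_add) graded_lie" and B z
    unfolding env_exp_def using that
    by (intro env_circ_apply spanning summable_norm_exp_coeffs)
  have apply_real: "env_apply L a z \<in> env_circ L B"
    if "degree_one_basis L B" "z \<in> env_circ_plus L B"
      "\<forall>\<xi>::complex. (\<lambda>m. of_real (a m) * \<xi> ^ m) sums f \<xi>" for B z a f
  proof (rule env_circ_apply[OF L spanning])
    \<comment> \<open>The complex series with real coefficients controls their absolute values,
      while the resulting series stays real.\<close>
    show "summable (\<lambda>m. norm (a m) * r ^ m)" if "0 \<le> r" for r
      using summable_norm_entire[OF \<open>\<forall>\<xi>. _ \<xi>\<close> that] by simp
  qed fact+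
  \<comment> \<open>Stated for spanning sets to cover both a basis of the complexification and the
    image of a real basis.\<close>
  have apply_complex: "env_apply LC a z \<in> env_circ LC B"
    if "degree_one_spanning LC B" "z \<in> env_circ_plus LC B" "\<forall>\<xi>. (\<lambda>m. a m * \<xi> ^ m) sums f \<xi>" for B z a f
    by (rule env_circ_apply[OF LC that(1,2)]) (rule summable_norm_entire[OF that(3)])
  have apply_extended: "env_apply LC a (\<lambda>p. env_to_complex L (z p)) \<in> env_circ LC (to_complex ` B)"
    if "degree_one_basis L B" "z \<in> env_circ_plus L B" "\<forall>\<xi>. (\<lambda>m. a m * \<xi> ^ m) sums f \<xi>" for B z a f
    using degree_one_spanning_complexification[OF L spanning] env_circ_plus_to_complex[OF L spanning]
    by (intro apply_complex) (use that in \<open>auto simp: LC_def\<close>)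
  show ?thesis
    by (intro conjI allI impI; elim conjE)
       (rule env_circ_mult[OF L spanning] env_circ_mult[OF LC spanning] change[OF L] change[OF LC]
          apply_extended apply_real apply_complex[OF spanning] exp[OF L] exp[OF LC]; assumption)+
qed

end
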